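(* Let $G$ be a finitely generated group with an exact tessellation $\mathcal{T}_G=\{D_i\}_{i\in I}$ of its action on a connected cone $P$, let $H<G$ be a subgroup of finite index, fix $i_0\in I$ and let $K=G_{i_0}$ be the stabilizer of $D_{i_0}$ in $G$. Let $J\subset I$ be an $H$-fundamental subset. Then $H$ is finitely generated and $$l(H)\le|\mathcal{A}_J|-|\mathcal{N}_J|+l(K\cap H).$$ In particular, setting $m=|J|=|H\backslash G/K|$ and letting $k$ be the number of codimension one faces of any $D_i$ $(i\in I)$, we have $$l(H)\le mk+l(K\cap H).$$
   Context: For a finitely generated group $\Gamma$, $l(\Gamma)$ denotes the minimal number of generators of $\Gamma$, with $l(\{1\})=0$. Setting: $G$ is a finitely generated group and $H<G$ a subgroup with $[G:H]<\infty$. $G$ acts faithfully on a connected cone $P\subset\mathbb{R}^\rho$ ($\rho\ge2$) with vertex at the origin $0$ (possibly $0\notin P$), and there is an exact tessellation $\mathcal{T}_G=\{D_i\}_{i\in I}$ of this action: each $D_i\subset P$ is of dimension $\rho$ and is a cone over a closed finite polyhedron in $P$ with vertex $0$; $G$ acts transitively on the set $\mathcal{T}_G$ by $(g,D_i)\mapsto g(D_i)$; and for each $i\in I$: (1) $P=\bigcup_{g\in G}g(D_i)$; (2) $G_i:=\{g\in G: g(D_i)=D_i\}$ is finite (not necessarily trivial); (3) for $i'\ne i$, $D_i\cap D_{i'}$ is either empty or exactly one face of codimension $\ge1$, possibly $\{0\}$, of both $D_i$ and $D_{i'}$; (4) for each codimension one face $\Delta$ of $D_i$ there is a unique $i'\in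 I$ with $D_i\cap D_{i'}=\Delta$. By transitivity the number $k$ of codimension one faces of $D_i$ is independent of $i$. A subset $J\subset I$ is called $H$-fundamental if (1a) $P=\bigcup_{g\in H,\,j\in J}g(D_j)$; and (2a) if $j,j'\in J$ and $j\ne j'$, then $g(D_j)\ne D_{j'}$ for every $g\in H$. For $i\ne i'$, $D_{i'}$ is adjacent to $D_i$ if $D_i\cap D_{i'}$ is a codimension one face of both. Put $\mathcal{A}_J=\{(j,i)\in J\times I: D_j\text{ is adjacent to }D_i\}$ and $\mathcal{N}_J=\{(j,j')\in J\times J: D_j\text{ is adjacent to }D_{j'}\}$.
   Formalization: The interior of the connected cone P is also assumed connected (the bound fails if pieces of P meet only in codimension at least two), G is taken to act on P by homeomorphisms, and each D_i is a cone over a compact convex polyhedron not containing 0. *)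

theory Defs
  imports
    "HOL-Analysis.Analysis"
    "HOL-Algebra.Generated_Groups"
    "HOL-Algebra.Group_Action"
begin

definition finitely_generated :: "('g, 'm) monoid_scheme \<Rightarrow> bool" where
  "finitely_generated G \<longleftrightarrow>
     (\<exists>S. finite S \<and> S \<subseteq> carrier G \<and> generate G S = carrier G)"

text \<open>
  The minimal number of generators. It is \<open>0\<close> for the trivial group, because the empty set
  generates the trivial subgroup; it is only meaningful for finitely generated groups.
\<close>

definition min_generators :: "('g, 'm) monoid_scheme \<Rightarrow> nat" where
  "min_generators G =
     (LEAST n. \<exists>S. finite S \<and> S \<subseteq> carrier G \<and> generate G S = carrier G \<and> card S = n)"

definition double_cosets :: "('g, 'm) monoid_scheme \<Rightarrow> 'g set \<Rightarrow> 'g set \<Rightarrow> 'g set set" where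
  "double_cosets G H K =
     {{h \<otimes>\<^bsub>G\<^esub> g \<otimes>\<^bsub>G\<^esub> k | h k. h \<in> H \<and> k \<in> K} | g. g \<in> carrier G}"

text \<open>
  \<open>D\<close> is a full-dimensional cone with vertex \<open>0\<close> over a compact convex polyhedron \<open>Q\<close> in \<open>P\<close>.
  The library's \<open>cone hull Q\<close> always contains the vertex \<open>0\<close>; intersecting with \<open>P\<close> drops the
  vertex exactly when \<open>0\<close> is not in \<open>P\<close>, and changes nothing else when \<open>P\<close> is a cone.
  Since \<open>0\<close> is not in \<open>Q\<close>, the faces of \<open>D\<close> are those of \<open>cone hull Q\<close>, with \<open>0\<close> removed in
  the case that \<open>0\<close> is not in \<open>P\<close>.
\<close>

definition polyhedral_cone_in :: "(real ^ 'n) set \<Rightarrow> (real ^ 'n) set \<Rightarrow> bool" where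
  "polyhedral_cone_in P D \<longleftrightarrow>
     (\<exists>Q. polytope Q \<and> Q \<subseteq> P \<and> 0 \<notin> Q \<and> D = P \<inter> cone hull Q) \<and>
     aff_dim D = int CARD('n)"

definition tile_stabilizer ::
    "('g, 'm) monoid_scheme \<Rightarrow> ('g \<Rightarrow> 'a \<Rightarrow> 'a) \<Rightarrow> 'a set \<Rightarrow> 'g set" where
  "tile_stabilizer G \<phi> C = {g \<in> carrier G. \<phi> g ` C = C}"

text \<open>
  Conventions for the action and the cone:

  \<^item> \<open>P\<close> is a cone with vertex \<open>0\<close>, where \<open>0\<close> itself may be missing: \<open>insert 0 P\<close> is a cone in
    the sense of the library, equivalently \<open>P\<close> is closed under scaling by positive reals.

  \<^item> \<open>G\<close> acts by homeomorphisms of \<open>P\<close>. In particular, every linear action is covered.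
    Some regularity is needed for codimension one faces to be mapped to codimension one faces.

  \<^item> Connectedness of the full-dimensional object \<open>P\<close> is required of its interior as well.
    (It then follows for \<open>P\<close> itself, as the tiles are full-dimensional; for open \<open>P\<close> the two
    requirements coincide, and both hold for convex \<open>P\<close>.) If pieces of \<open>P\<close> may be joined only
    along sets of codimension at least two, adjacency need not connect all tiles and the bound
    on the number of generators fails. Example in dimension 3: let \<open>P\<close> consist of the points
    with \<open>x * y \<noteq> 0\<close> or \<open>x = y = 0\<close>, and let \<open>G\<close> be generated by \<open>diag(1,4,1)\<close> and the three
    sign changes of coordinates, so that \<open>G\<close> needs 4 generators. \<open>G\<close> is simply transitive on
    the images of the tile \<open>0 \<le> x \<le> y \<le> 4 * x\<close>, \<open>0 \<le> z\<close>, which has only 3 facets.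
\<close>

locale exact_tessellation = faithful_action G P \<phi>
  for G :: "('g, 'm) monoid_scheme" (structure)
    and P :: "(real ^ 'n) set"
    and \<phi> :: "'g \<Rightarrow> real ^ 'n \<Rightarrow> real ^ 'n" +
  fixes I :: "'i set"
    and D :: "'i \<Rightarrow> (real ^ 'n) set"
  assumes dim_ge_2: "CARD('n) \<ge> 2"
    and cone_P: "cone (insert 0 P)"
    and connected_P: "connected P"
    and connected_interior_P: "connected (interior P)"
    and continuous_action: "\<And>g. g \<in> carrier G \<Longrightarrow> continuous_on P (\<phi> g)"
    and tile: "\<And>i. i \<in> I \<Longrightarrow> polyhedral_cone_in P (D i)"
    and tiles_invariant: "\<And>g i. g \<in> carrier G \<Longrightarrow> i \<in> I \<Longrightarrow> \<phi> g ` D i \<in> D ` I"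
    and tiles_transitive: "\<And>i i'. i \<in> I \<Longrightarrow> i' \<in> I \<Longrightarrow> \<exists>g\<in>carrier G. \<phi> g ` D i = D i'"
    and cover: "\<And>i. i \<in> I \<Longrightarrow> P = (\<Union>g\<in>carrier G. \<phi> g ` D i)"
    and finite_stabilizer: "\<And>i. i \<in> I \<Longrightarrow> finite (tile_stabilizer G \<phi> (D i))"
    and face_to_face: "\<And>i i'. i \<in> I \<Longrightarrow> i' \<in> I \<Longrightarrow> i' \<noteq> i \<Longrightarrow>
          D i \<inter> D i' = {} \<or>
          (D i \<inter> D i') face_of D i \<and> (D i \<inter> D i') face_of D i' \<and>
            aff_dim (D i \<inter> D i') \<le> int CARD('n) - 1"
    and unique_neighbour: "\<And>i \<Delta>. i \<in> I \<Longrightarrow> \<Delta> facet_of D i \<Longrightarrow>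
          \<exists>!i'. i' \<in> I \<and> D i \<inter> D i' = \<Delta>"

definition fundamental_subset ::
    "'g set \<Rightarrow> 'a set \<Rightarrow> ('g \<Rightarrow> 'a \<Rightarrow> 'a) \<Rightarrow> 'i set \<Rightarrow> ('i \<Rightarrow> 'a set) \<Rightarrow> 'i set \<Rightarrow> bool" where
  "fundamental_subset H P \<phi> I D J \<longleftrightarrow>
     J \<subseteq> I \<and>
     P = (\<Union>g\<in>H. \<Union>j\<in>J. \<phi> g ` D j) \<and>
     (\<forall>j\<in>J. \<forall>j'\<in>J. j \<noteq> j' \<longrightarrow> (\<forall>g\<in>H. \<phi> g ` D j \<noteq> D j'))"

definition adjacent :: "('i \<Rightarrow> 'a::euclidean_space set) \<Rightarrow> 'i \<Rightarrow> 'i \<Rightarrow> bool" where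
  "adjacent D i i' \<longleftrightarrow>
     i \<noteq> i' \<and> (D i \<inter> D i') facet_of D i \<and> (D i \<inter> D i') facet_of D i'"

definition adjacent_pairs ::
    "('i \<Rightarrow> 'a::euclidean_space set) \<Rightarrow> 'i set \<Rightarrow> 'i set \<Rightarrow> ('i \<times> 'i) set" where
  "adjacent_pairs D A B = {(i, i'). i \<in> A \<and> i' \<in> B \<and> adjacent D i i'}"

end

theory Submission imports Defs
begin

text \<open>
  \<open>H\<close> acts on the adjacency graph of the tiles, which is connected: a line segment in the interior
  of \<open>P\<close> generically avoids the countably many intersections of two facets of a tile, so it passes
  from tile to tile through the relative interiors of facets.

  Let \<open>L \<subseteq> H\<close> contain the stabilizer of one tile. To force \<open>L = H\<close> by walking through the graph, it
  suffices that, for each \<open>j \<in> J\<close>, \<open>L\<close> contains elements generating the stabilizer of \<open>j\<close> modulo the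
  pointwise fixer of its neighbours, and one crossing element for each stabilizer orbit of
  neighbours that does not meet \<open>J\<close>; the fixer itself is contained in the stabilizer of the tile from
  which \<open>j\<close> is reached. A group acting on \<open>n\<close> points with \<open>c\<close> orbits is generated modulo its kernel
  by \<open>n - c\<close> elements, so each \<open>j\<close> contributes at most as many generators as it has neighbours
  outside \<open>J\<close>. Hence the stabilizers of the other tiles of \<open>J\<close> need no generators of their own.
\<close>

section \<open>Generators from an action on a graph\<close>

text \<open>With \<open>r x y\<close> read as "some group element maps \<open>x\<close> to
  \<open>y\<close>", the result is a system of orbit representatives containing the prescribed
  points \<open>R\<^sub>0\<close>. Both directions of \<open>r\<close> appear because
  \<open>r\<close> need not be symmetric.\<close>

lemma extend_to_maximal_pairwise:
  assumes "finite Y" and "R\<^sub>0 \<subseteq> Y" and "pairwise (\<lambda>x y. \<not> r x y) R\<^sub>0"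
  obtains R where "R\<^sub>0 \<subseteq> R" and "R \<subseteq> Y" and "pairwise (\<lambda>x y. \<not> r x y) R"
    and "\<And>y. y \<in> Y \<Longrightarrow> y \<in> R \<or> (\<exists>x\<in>R. r x y \<or> r y x)"
proof -
  define F where "F = {R. R\<^sub>0 \<subseteq> R \<and> R \<subseteq> Y \<and> pairwise (\<lambda>x y. \<not> r x y) R}"
  have "finite F"
    using assms(1) by (auto simp: F_def intro: finite_subset[of _ "Pow Y"])
  moreover have "F \<noteq> {}"
    using assms by (auto simp: F_def)
  ultimately have "\<exists>R\<in>F. \<forall>R'\<in>F. R \<subseteq> R' \<longrightarrow> R = R'"
    by (rule finite_has_maximal)
  then obtain R where R: "R \<in> F" and max: "\<And>R'. R' \<in> F \<Longrightarrow> R \<subseteq> R' \<Longrightarrow> R = R'"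
    by blast
  have "y \<in> R \<or> (\<exists>x\<in>R. r x y \<or> r y x)" if "y \<in> Y" for y
  proof (rule ccontr)
    assume "\<not> ?thesis"
    then have "insert y R \<in> F" "y \<notin> R"
      using R that by (auto simp: F_def pairwise_insert)
    then show False
      using max[of "insert y R"] by blast
  qed
  then show thesis
    using that R by (auto simp: F_def)
qed

context group_action
begin

interpretation group G
  using group_hom group_hom.axioms(1) by auto

lemma image_by_one: "x \<in> E \<Longrightarrow> \<phi> \<one> x = x"
  using id_eq_one by (metis restrict_apply')

lemma subgroup_fixing:
  assumes "subgroup S G" and "x \<in> E"
  shows "subgroup {s \<in> S. \<phi> s x = x} G"
proof -
  have "{s \<in> S. \<phi> s x = x} = S \<inter> stabilizer G \<phi> x"
    using subgroup.subset[OF assms(1)] by (auto simp: stabilizer_def)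
  then show ?thesis
    using subgroups_Inter_pair[OF assms(1) stabilizer_subgroup[OF assms(2)]] by simp
qed

text \<open>The stabilizer of \<open>\<phi> m x\<close> is the conjugate of that of \<open>x\<close>
  by \<open>m\<close>, and \<open>m\<close> lies in \<open>L\<close>.\<close>

lemma stabilizer_image_subset:
  assumes L: "subgroup L G" and "m \<in> L" and "x \<in> E" and sub: "stabilizer G \<phi> x \<subseteq> L"
  shows "stabilizer G \<phi> (\<phi> m x) \<subseteq> L"
proof
  fix s assume s: "s \<in> stabilizer G \<phi> (\<phi> m x)"
  have m: "m \<in> carrier G" and sG: "s \<in> carrier G" and fixed: "\<phi> s (\<phi> m x) = \<phi> m x"
    using s subgroup.mem_carrier[OF L \<open>m \<in> L\<close>] by (auto simp: stabilizer_def)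
  have "\<phi> (inv m \<otimes> (s \<otimes> m)) x = x"
    using m sG \<open>x \<in> E\<close> fixed orbit_sym_aux[OF m \<open>x \<in> E\<close> refl]
    by (simp add: composition_rule)
  then have "inv m \<otimes> (s \<otimes> m) \<in> L"
    using sub m sG by (auto simp: stabilizer_def)
  then have "m \<otimes> (inv m \<otimes> (s \<otimes> m)) \<otimes> inv m \<in> L"
    using subgroup.m_closed[OF L] subgroup.m_inv_closed[OF L] \<open>m \<in> L\<close> by simp
  moreover have "m \<otimes> (inv m \<otimes> (s \<otimes> m)) \<otimes> inv m = s"
    using m sG by (simp flip: m_assoc, simp add: m_assoc)
  ultimately show "s \<in> L" by simp
qed

text \<open>
  Passing to the stabilizer of a point \<open>x\<close> of \<open>R\<close> splits the rest of the orbit of \<open>x\<close> into smaller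
  orbits; adding one representative of each to \<open>R\<close> pays for one coset representative each.
\<close>

lemma generators_modulo_pointwise_fixer:
  assumes "finite X" and "X \<subseteq> E" and "subgroup S G"
    and "\<And>s x. s \<in> S \<Longrightarrow> x \<in> X \<Longrightarrow> \<phi> s x \<in> X"
    and "R \<subseteq> X" and "pairwise (\<lambda>x y. \<forall>s\<in>S. \<phi> s x \<noteq> y) R"
  shows "\<exists>T. T \<subseteq> S \<and> finite T \<and> card T + card R \<le> card X \<and>
    (\<forall>L. subgroup L G \<longrightarrow> T \<subseteq> L \<longrightarrow> {s \<in> S. \<forall>x\<in>X. \<phi> s x = x} \<subseteq> L \<longrightarrow> S \<subseteq> L)"
  using assms
proof (induction X arbitrary: S R rule: finite_psubset_induct)
  case (psubset X)
  note XE = \<open>X \<subseteq> E\<close> and S = \<open>subgroup S G\<close>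
  note inX = \<open>\<And>s x. s \<in> S \<Longrightarrow> x \<in> X \<Longrightarrow> \<phi> s x \<in> X\<close>
  have SG: "s \<in> carrier G" if "s \<in> S" for s
    using subgroup.mem_carrier[OF S that] .
  show ?case
  proof (cases "X = {}")
    case True
    then show ?thesis
      using psubset.prems by (intro exI[of _ "{}"]) auto
  next
    case False
    obtain x\<^sub>0 where "x\<^sub>0 \<in> X" using False by blast
    \<comment> \<open>A point of the independent set is needed to stabilize. If \<open>R\<close> is
      empty, any point of \<open>X\<close> serves: a larger set only strengthens the bound.\<close>
    define R\<^sub>1 where "R\<^sub>1 = (if R = {} then {x\<^sub>0} else R)"
    have R1: "R \<subseteq> R\<^sub>1" "R\<^sub>1 \<subseteq> X" and pw: "pairwise (\<lambda>x y. \<forall>s\<in>S. \<phi> s x \<noteq> y) R\<^sub>1"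
      using psubset.prems(4,5) \<open>x\<^sub>0 \<in> X\<close> by (auto simp: R\<^sub>1_def)
    have "R\<^sub>1 \<noteq> {}" by (simp add: R\<^sub>1_def)
    then obtain x where x: "x \<in> R\<^sub>1" by blast
    have xX: "x \<in> X" and xE: "x \<in> E" using x R1 XE by auto
    define S' where "S' = {s \<in> S. \<phi> s x = x}"
    have S': "subgroup S' G"
      unfolding S'_def by (rule subgroup_fixing[OF S xE])
    have S'S: "S' \<subseteq> S" by (auto simp: S'_def)
    define Y where "Y = {\<phi> s x | s. s \<in> S} - {x}"
    have YX: "Y \<subseteq> X - {x}" using inX xX by (auto simp: Y_def)
    then have "finite Y" using psubset.hyps finite_subset by blast
    \<comment> \<open>\<open>W\<close> represents the orbits of the stabilizer \<open>S'\<close> of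
      \<open>x\<close> on the rest \<open>Y\<close> of the orbit of \<open>x\<close>.\<close>
    then obtain W where WY: "W \<subseteq> Y" and pwW: "pairwise (\<lambda>x y. \<not> (\<exists>s\<in>S'. \<phi> s x = y)) W"
      and W: "\<And>y. y \<in> Y \<Longrightarrow> y \<in> W \<or> (\<exists>w\<in>W. (\<exists>s\<in>S'. \<phi> s w = y) \<or> (\<exists>s\<in>S'. \<phi> s y = w))"
      by (rule extend_to_maximal_pairwise[of Y "{}" "\<lambda>x y. \<exists>s\<in>S'. \<phi> s x = y"]) auto
    have reach: "\<exists>w\<in>W. \<exists>s\<in>S'. \<phi> s w = y" if "y \<in> Y" for y
    proof -
      have yE: "y \<in> E" using that YX XE by blast
      consider "y \<in> W" | w s where "w \<in> W" "s \<in> S'" "\<phi> s w = y"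
        | w s where "w \<in> W" "s \<in> S'" "\<phi> s y = w"
        using W[OF \<open>y \<in> Y\<close>] by blast
      then show ?thesis
      proof cases
        case 1
        then show ?thesis
          using image_by_one[OF yE] subgroup.one_closed[OF S'] by blast
      next
        case 2
        then show ?thesis by blast
      next
        case 3
        then have "\<phi> (inv s) w = y"
          using orbit_sym_aux SG S'S yE by blast
        with 3 show ?thesis
          using subgroup.m_inv_closed[OF S'] by blast
      qed
    qed
    \<comment> \<open>Members of \<open>W\<close> lie in the \<open>S\<close>-orbit of
      \<open>x\<close>, which contains no other member of \<open>R\<^sub>1\<close>.\<close>
    have cross: "\<phi> s w \<noteq> r" "\<phi> s r \<noteq> w" if wW: "w \<in> W" and "r \<in> R\<^sub>1 - {x}" "s \<in> S" for w r s
    proof -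
      obtain t where t: "t \<in> S" "\<phi> t x = w"
        using WY wW unfolding Y_def by blast
      have rE: "r \<in> E" using that R1 XE by auto
      have "r \<in> R\<^sub>1" "x \<noteq> r" using \<open>r \<in> R\<^sub>1 - {x}\<close> by auto
      then have "\<forall>u\<in>S. \<phi> u x \<noteq> r"
        by (rule pairwiseD[OF pw x])
      then have no: "\<phi> u x \<noteq> r" if "u \<in> S" for u
        using that by blast
      have "\<phi> s w = \<phi> (s \<otimes> t) x"
        using t that SG xE by (simp add: composition_rule)
      then show "\<phi> s w \<noteq> r"
        using no subgroup.m_closed[OF S \<open>s \<in> S\<close> t(1)] by auto
      show "\<phi> s r \<noteq> w"
      proof
        assume "\<phi> s r = w"
        then have "\<phi> (inv s) w = r"
          using orbit_sym_aux SG \<open>s \<in> S\<close> rE by blast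
        then have "\<phi> (inv s \<otimes> t) x = r"
          using t that SG xE by (simp add: composition_rule)
        then show False
          using no subgroup.m_closed[OF S subgroup.m_inv_closed[OF S \<open>s \<in> S\<close>] t(1)] by blast
      qed
    qed
    have disj: "(R\<^sub>1 - {x}) \<inter> W = {}"
    proof -
      have "w \<notin> R\<^sub>1 - {x}" if "w \<in> W" for w
        using cross(1)[OF that, of w \<one>] image_by_one[of w] subgroup.one_closed[OF S] that WY YX XE
        by blast
      then show ?thesis by blast
    qed
    \<comment> \<open>Its size \<open>card R\<^sub>1 - 1 + card W\<close> leaves room in the bound
      for \<open>card W\<close> coset representatives.\<close>
    define R' where "R' = (R\<^sub>1 - {x}) \<union> W"
    have "\<exists>T'. T' \<subseteq> S' \<and> finite T' \<and> card T' + card R' \<le> card (X - {x}) \<and>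
      (\<forall>L. subgroup L G \<longrightarrow> T' \<subseteq> L \<longrightarrow>
        {s \<in> S'. \<forall>y\<in>X - {x}. \<phi> s y = y} \<subseteq> L \<longrightarrow> S' \<subseteq> L)"
    proof (rule psubset.IH)
      show "X - {x} \<subset> X" using xX by blast
      show "X - {x} \<subseteq> E" using XE by blast
      show "subgroup S' G" by (rule S')
      show "R' \<subseteq> X - {x}" using R1 WY YX by (auto simp: R'_def)
      show "\<phi> s y \<in> X - {x}" if "s \<in> S'" "y \<in> X - {x}" for s y
      proof -
        have "\<phi> s y \<noteq> \<phi> s x"
          using inj_prop[of s] SG S'S that xE XE by (auto simp: inj_on_def)
        then show ?thesis
          using that inX S'S by (auto simp: S'_def)
      qed
      show "pairwise (\<lambda>x y. \<forall>s\<in>S'. \<phi> s x \<noteq> y) R'"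
        using pw pwW cross S'S unfolding R'_def pairwise_def by blast
    qed
    then obtain T' where T': "T' \<subseteq> S'" "finite T'" "card T' + card R' \<le> card (X - {x})"
      and gen': "\<And>L. subgroup L G \<Longrightarrow> T' \<subseteq> L \<Longrightarrow>
        {s \<in> S'. \<forall>y\<in>X - {x}. \<phi> s y = y} \<subseteq> L \<Longrightarrow> S' \<subseteq> L"
      by blast
    have "\<forall>w\<in>W. \<exists>t\<in>S. \<phi> t x = w" using WY by (auto simp: Y_def)
    then obtain t where t: "\<And>w. w \<in> W \<Longrightarrow> t w \<in> S \<and> \<phi> (t w) x = w" by metis
    have fin: "finite W" "finite R\<^sub>1"
      using WY \<open>finite Y\<close> R1 psubset.hyps finite_subset by blast+
    have "card R' = card (R\<^sub>1 - {x}) + card W"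
      unfolding R'_def using fin disj by (intro card_Un_disjoint) auto
    moreover have "card (R\<^sub>1 - {x}) + 1 = card R\<^sub>1"
      using fin x by (metis Suc_eq_plus1 card_Suc_Diff1)
    moreover have "card (X - {x}) + 1 = card X"
      using psubset.hyps xX by (metis Suc_eq_plus1 card_Suc_Diff1)
    moreover have "card R \<le> card R\<^sub>1"
      using R1 fin card_mono by blast
    moreover have "card (T' \<union> t ` W) \<le> card T' + card W"
      using card_Un_le[of T' "t ` W"] card_image_le[OF fin(1), of t] by linarith
    ultimately have "card (T' \<union> t ` W) + card R \<le> card X"
      using T'(3) by linarith
    moreover have "S \<subseteq> L"
      if L: "subgroup L G" and TL: "T' \<union> t ` W \<subseteq> L"
        and fixL: "{s \<in> S. \<forall>x\<in>X. \<phi> s x = x} \<subseteq> L" for L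
    proof
      \<comment> \<open>An element of \<open>S'\<close> that fixes \<open>X - {x}\<close> pointwise
        fixes all of \<open>X\<close>, so \<open>fixL\<close> covers the fixer in the induction
        hypothesis.\<close>
      have S'L: "S' \<subseteq> L"
        using gen'[OF L] TL fixL by (force simp: S'_def)
      fix s assume s: "s \<in> S"
      show "s \<in> L"
      proof (cases "\<phi> s x = x")
        case True
        then show ?thesis using s S'L by (auto simp: S'_def)
      next
        case False
        then have "\<phi> s x \<in> Y" using s by (auto simp: Y_def)
        then obtain w s' where w: "w \<in> W" "s' \<in> S'" "\<phi> s' w = \<phi> s x"
          using reach by blast
        \<comment> \<open>\<open>?u\<close> and \<open>s\<close> send \<open>x\<close> to the same
          point, so they differ by an element of \<open>S'\<close>.\<close>
        let ?u = "s' \<otimes> t w"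
        have "t w \<in> L" using w(1) TL by blast
        then have u: "?u \<in> S" "?u \<in> L" "?u \<in> carrier G"
          using w(2) t[OF w(1)] S'S S'L SG subgroup.m_closed[OF S] subgroup.m_closed[OF L] by auto
        have "\<phi> ?u x = \<phi> s x"
          using w t[OF w(1)] SG S'S xE by (auto simp: composition_rule)
        then have "\<phi> (inv ?u \<otimes> s) x = x"
          using u SG[OF s] xE orbit_sym_aux[OF u(3) xE] by (simp add: composition_rule del: inv_mult_group)
        then have "inv ?u \<otimes> s \<in> L"
          using u s S'L subgroup.m_closed[OF S subgroup.m_inv_closed[OF S u(1)] s]
          by (auto simp: S'_def)
        then have "?u \<otimes> (inv ?u \<otimes> s) \<in> L"
          using u subgroup.m_closed[OF L] by blast
        moreover have "?u \<otimes> (inv ?u \<otimes> s) = s"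
          using u SG[OF s] by (simp add: r_inv flip: m_assoc del: inv_mult_group)
        ultimately show ?thesis by simp
      qed
    qed
    moreover have "T' \<union> t ` W \<subseteq> S" "finite (T' \<union> t ` W)"
      using T' fin t S'S by auto
    ultimately show ?thesis
      by (intro exI[of _ "T' \<union> t ` W"] conjI allI impI)
  qed
qed

text \<open>\<open>conn\<close> is connectedness of the graph, phrased through adjacency-closed
  sets. The conclusion tests \<open>T\<close> against all subgroups \<open>L\<close>, so that
  generators of the one remaining stabilizer, that of \<open>j\<^sub>0\<close>, can be counted
  separately.\<close>

theorem generators_from_adjacency:
  fixes adj :: "'c \<Rightarrow> 'c \<Rightarrow> bool"
  assumes JE: "J \<subseteq> E" and finJ: "finite J"
    and fin: "\<And>j. j \<in> J \<Longrightarrow> finite {i \<in> E. adj j i}"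
    and sym: "\<And>i i'. adj i i' \<Longrightarrow> adj i' i"
    and inv: "\<And>g i i'. g \<in> carrier G \<Longrightarrow> i \<in> E \<Longrightarrow> i' \<in> E \<Longrightarrow> adj i i' \<Longrightarrow> adj (\<phi> g i) (\<phi> g i')"
    and conn: "\<And>C. C \<subseteq> E \<Longrightarrow> C \<noteq> {} \<Longrightarrow> (\<And>i i'. i \<in> C \<Longrightarrow> i' \<in> E \<Longrightarrow> adj i i' \<Longrightarrow> i' \<in> C) \<Longrightarrow> C = E"
    and cov: "\<And>i. i \<in> E \<Longrightarrow> \<exists>g\<in>carrier G. \<exists>j\<in>J. \<phi> g j = i"
    and indep: "\<And>g j j'. g \<in> carrier G \<Longrightarrow> j \<in> J \<Longrightarrow> j' \<in> J \<Longrightarrow> \<phi> g j = j' \<Longrightarrow> j = j'"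
    and j0: "j\<^sub>0 \<in> J"
  shows "\<exists>T. T \<subseteq> carrier G \<and> finite T \<and>
    card T + card {(j, i). j \<in> J \<and> i \<in> J \<and> adj j i} \<le> card {(j, i). j \<in> J \<and> i \<in> E \<and> adj j i} \<and>
    (\<forall>L. subgroup L G \<longrightarrow> T \<subseteq> L \<longrightarrow> stabilizer G \<phi> j\<^sub>0 \<subseteq> L \<longrightarrow> L = carrier G)"
proof -
  let ?X = "\<lambda>j. {i \<in> E. adj j i}" and ?S = "\<lambda>j. stabilizer G \<phi> j"
  \<comment> \<open>The two tasks of the generators chosen at \<open>j\<close>: generating its
    stabilizer modulo the pointwise fixer of the neighbours, and reaching each neighbour, up to the
    stabilizer, from \<open>J\<close>. They are charged only to the neighbours outside
    \<open>J\<close>.\<close>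
  define Q where "Q j U \<longleftrightarrow>
      U \<subseteq> carrier G \<and> finite U \<and> card U + card {i \<in> J. adj j i} \<le> card (?X j) \<and>
      (\<forall>L. subgroup L G \<longrightarrow> U \<subseteq> L \<longrightarrow>
         ({s \<in> ?S j. \<forall>x\<in>?X j. \<phi> s x = x} \<subseteq> L \<longrightarrow> ?S j \<subseteq> L) \<and>
         (\<forall>i\<in>?X j. \<exists>s\<in>?S j. \<exists>c\<in>L. \<exists>j'\<in>J. \<phi> s (\<phi> c j') = i))" for j U
  have "\<exists>U. Q j U" if j: "j \<in> J" for j
  proof -
    have jE: "j \<in> E" using j JE by blast
    have S: "subgroup (?S j) G" by (rule stabilizer_subgroup[OF jE])
    have SG: "s \<in> carrier G" if "s \<in> ?S j" for s using that by (auto simp: stabilizer_def)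
    have inX: "\<phi> s x \<in> ?X j" if "s \<in> ?S j" "x \<in> ?X j" for s x
      using that inv[of s j x] jE element_image[of s x] by (auto simp: stabilizer_def)
    \<comment> \<open>Members of \<open>J\<close> are inequivalent under the whole group, so all
      neighbours in \<open>J\<close> can serve as representatives.\<close>
    have "pairwise (\<lambda>x y. \<not> (\<exists>s\<in>?S j. \<phi> s x = y)) {i \<in> J. adj j i}"
      using indep SG by (fastforce simp: pairwise_def)
    then obtain R where R: "{i \<in> J. adj j i} \<subseteq> R" "R \<subseteq> ?X j"
      and pw: "pairwise (\<lambda>x y. \<not> (\<exists>s\<in>?S j. \<phi> s x = y)) R"
      and max: "\<And>y. y \<in> ?X j \<Longrightarrow> y \<in> R \<or> (\<exists>x\<in>R. (\<exists>s\<in>?S j. \<phi> s x = y) \<or> (\<exists>s\<in>?S j. \<phi> s y = x))"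
      using extend_to_maximal_pairwise[of "?X j" "{i \<in> J. adj j i}" "\<lambda>x y. \<exists>s\<in>?S j. \<phi> s x = y"]
        fin[OF j] JE by blast
    have reach: "\<exists>r\<in>R. \<exists>s\<in>?S j. \<phi> s r = i" if iX: "i \<in> ?X j" for i
    proof -
      consider "i \<in> R" | r s where "r \<in> R" "s \<in> ?S j" "\<phi> s r = i"
        | r s where "r \<in> R" "s \<in> ?S j" "\<phi> s i = r"
        using max[OF iX] by blast
      then show ?thesis
      proof cases
        case 1
        then show ?thesis
          using image_by_one[of i] iX subgroup.one_closed[OF S] by blast
      next
        case 2
        then show ?thesis by blast
      next
        case 3
        then have "\<phi> (inv\<^bsub>G\<^esub> s) r = i"
          using orbit_sym_aux SG iX by blast
        with 3 show ?thesis
          using subgroup.m_inv_closed[OF S] by blast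
      qed
    qed
    have "\<exists>T. T \<subseteq> ?S j \<and> finite T \<and> card T + card R \<le> card (?X j) \<and>
      (\<forall>L. subgroup L G \<longrightarrow> T \<subseteq> L \<longrightarrow> {s \<in> ?S j. \<forall>x\<in>?X j. \<phi> s x = x} \<subseteq> L \<longrightarrow> ?S j \<subseteq> L)"
      by (rule generators_modulo_pointwise_fixer[OF fin[OF j] _ S inX R(2)])
        (use pw in auto)
    then obtain T where T: "T \<subseteq> ?S j" "finite T" "card T + card R \<le> card (?X j)"
      and gen: "\<And>L. subgroup L G \<Longrightarrow> T \<subseteq> L \<Longrightarrow> {s \<in> ?S j. \<forall>x\<in>?X j. \<phi> s x = x} \<subseteq> L \<Longrightarrow> ?S j \<subseteq> L"
      by blast
    obtain c where c: "\<And>r. r \<in> E \<Longrightarrow> c r \<in> carrier G \<and> (\<exists>j'\<in>J. \<phi> (c r) j' = r)"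
      using cov by metis
    have finR: "finite R" using R(2) fin[OF j] finite_subset by blast
    \<comment> \<open>Representatives in \<open>J\<close> need no crossing element, which is the
      saving: \<open>T\<close> costs at most \<open>card (?X j) - card R\<close>, the crossing
      elements at most \<open>card (R - J)\<close>.\<close>
    let ?U = "T \<union> c ` (R - J)"
    have "{i \<in> J. adj j i} = R \<inter> J" using R by blast
    then have "card {i \<in> J. adj j i} + card (R - J) = card R"
      using card_Int_Diff[OF finR, of J] by simp
    moreover have "card ?U \<le> card T + card (R - J)"
      using card_Un_le[of T "c ` (R - J)"] card_image_le[of "R - J" c] finR by simp
    ultimately have "card ?U + card {i \<in> J. adj j i} \<le> card (?X j)"
      using T(3) by linarith
    moreover have "?U \<subseteq> carrier G" "finite ?U"
      using T SG c R(2) finR by auto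
    moreover have "?S j \<subseteq> L"
      if "subgroup L G" "?U \<subseteq> L" "{s \<in> ?S j. \<forall>x\<in>?X j. \<phi> s x = x} \<subseteq> L" for L
      using gen that by simp
    moreover have "\<exists>s\<in>?S j. \<exists>d\<in>L. \<exists>j'\<in>J. \<phi> s (\<phi> d j') = i"
      if L: "subgroup L G" and UL: "?U \<subseteq> L" and i: "i \<in> ?X j" for L i
    proof -
      obtain r s where r: "r \<in> R" "s \<in> ?S j" "\<phi> s r = i" using reach[OF i] by blast
      have rE: "r \<in> E" using r R by blast
      have "\<exists>d\<in>L. \<exists>j'\<in>J. \<phi> d j' = r"
      proof (cases "r \<in> J")
        case True
        then show ?thesis
          using image_by_one[OF rE] subgroup.one_closed[OF L] by blast
      next
        case False
        then show ?thesis using c[OF rE] r UL by blast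
      qed
      then show ?thesis using r by blast
    qed
    ultimately have "Q j ?U"
      unfolding Q_def by (intro conjI allI impI ballI)
    then show ?thesis ..
  qed
  then have "\<exists>U. \<forall>j\<in>J. Q j (U j)"
    by (intro bchoice) blast
  then obtain U where QU: "\<And>j. j \<in> J \<Longrightarrow> Q j (U j)" by blast
  have U: "U j \<subseteq> carrier G \<and> finite (U j) \<and> card (U j) + card {i \<in> J. adj j i} \<le> card (?X j)"
    if "j \<in> J" for j
    using QU[OF that] by (simp add: Q_def)
  have UL: "({s \<in> ?S j. \<forall>x\<in>?X j. \<phi> s x = x} \<subseteq> L \<longrightarrow> ?S j \<subseteq> L) \<and>
      (\<forall>i\<in>?X j. \<exists>s\<in>?S j. \<exists>c\<in>L. \<exists>j'\<in>J. \<phi> s (\<phi> c j') = i)"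
    if j: "j \<in> J" and L: "subgroup L G" "U j \<subseteq> L" for j L
  proof -
    have "\<forall>L. subgroup L G \<longrightarrow> U j \<subseteq> L \<longrightarrow>
        ({s \<in> ?S j. \<forall>x\<in>?X j. \<phi> s x = x} \<subseteq> L \<longrightarrow> ?S j \<subseteq> L) \<and>
        (\<forall>i\<in>?X j. \<exists>s\<in>?S j. \<exists>c\<in>L. \<exists>j'\<in>J. \<phi> s (\<phi> c j') = i)"
      using QU[OF j] unfolding Q_def by (elim conjE)
    then show ?thesis using L by (elim allE impE) auto
  qed
  let ?T = "\<Union>j\<in>J. U j"
  have "card ?T \<le> (\<Sum>j\<in>J. card (U j))"
    by (rule card_UN_le[OF finJ])
  moreover have "card {(j, i). j \<in> J \<and> i \<in> J \<and> adj j i} = (\<Sum>j\<in>J. card {i \<in> J. adj j i})"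
  proof -
    have "{(j, i). j \<in> J \<and> i \<in> J \<and> adj j i} = Sigma J (\<lambda>j. {i \<in> J. adj j i})" by auto
    then show ?thesis using finJ by simp
  qed
  moreover have "card {(j, i). j \<in> J \<and> i \<in> E \<and> adj j i} = (\<Sum>j\<in>J. card (?X j))"
  proof -
    have "{(j, i). j \<in> J \<and> i \<in> E \<and> adj j i} = Sigma J ?X" by auto
    then show ?thesis using finJ fin by simp
  qed
  moreover have "(\<Sum>j\<in>J. card (U j)) + (\<Sum>j\<in>J. card {i \<in> J. adj j i}) \<le> (\<Sum>j\<in>J. card (?X j))"
    using U by (simp flip: sum.distrib add: sum_mono)
  ultimately have "card ?T + card {(j, i). j \<in> J \<and> i \<in> J \<and> adj j i}
      \<le> card {(j, i). j \<in> J \<and> i \<in> E \<and> adj j i}"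
    by linarith
  moreover have "L = carrier G"
    if L: "subgroup L G" and TL: "?T \<subseteq> L" and sL: "?S j\<^sub>0 \<subseteq> L" for L
  proof -
    have LG: "l \<in> carrier G" if "l \<in> L" for l using subgroup.mem_carrier[OF L that] .
    \<comment> \<open>Both properties are propagated together: the stabilizer of \<open>i\<close> is
      used to cross to \<open>i'\<close> and then to recover the stabilizer of
      \<open>i'\<close>.\<close>
    let ?C = "{i \<in> E. ?S i \<subseteq> L \<and> (\<exists>l\<in>L. \<exists>j\<in>J. \<phi> l j = i)}"
    have "?C = E"
    proof (rule conn)
      show "?C \<subseteq> E" by blast
      have "j\<^sub>0 \<in> ?C"
        using j0 JE sL image_by_one[of j\<^sub>0] subgroup.one_closed[OF L] by blast
      then show "?C \<noteq> {}" by blast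
      fix i i' assume i: "i \<in> ?C" and i': "i' \<in> E" and adj: "adj i i'"
      then obtain l j where l: "l \<in> L" "j \<in> J" "\<phi> l j = i" and iE: "i \<in> E" and iL: "?S i \<subseteq> L"
        by blast
      have jE: "j \<in> E" using l JE by blast
      have backw: "\<phi> (inv\<^bsub>G\<^esub> l) i = j"
        using orbit_sym_aux[OF LG[OF l(1)] jE l(3)] .
      have il: "inv\<^bsub>G\<^esub> l \<in> L" by (rule subgroup.m_inv_closed[OF L l(1)])
      have jL: "?S j \<subseteq> L"
        using stabilizer_image_subset[OF L il iE iL] backw by simp
      \<comment> \<open>Pulled back by \<open>l\<close>, the edge starts at \<open>j\<close>, where
        the generators \<open>U j\<close> apply.\<close>
      have "adj j (\<phi> (inv\<^bsub>G\<^esub> l) i')"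
        using inv[OF LG[OF il] iE i' adj] backw by simp
      then have "\<phi> (inv\<^bsub>G\<^esub> l) i' \<in> ?X j"
        using element_image[OF LG[OF il] i' refl] by simp
      then obtain s c j' where s: "s \<in> ?S j" "c \<in> L" "j' \<in> J" "\<phi> s (\<phi> c j') = \<phi> (inv\<^bsub>G\<^esub> l) i'"
        using UL[OF l(2) L] TL l(2) by (smt (verit) UN_subset_iff)
      have j'E: "j' \<in> E" using s JE by blast
      define m where "m = l \<otimes> (s \<otimes> c)"
      have sL: "s \<in> L" using s jL by blast
      have m: "m \<in> L"
        unfolding m_def using l sL s L by (intro subgroup.m_closed)
      have "\<phi> m j' = \<phi> l (\<phi> (inv\<^bsub>G\<^esub> l) i')"
        unfolding m_def using s(4) LG l(1) sL s(2) j'E by (simp add: composition_rule)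
      also have "\<dots> = i'"
        using orbit_sym_aux[OF LG[OF il] i' refl] LG[OF l(1)] by simp
      finally have mi: "\<phi> m j' = i'" .
      have im: "inv\<^bsub>G\<^esub> m \<in> L" by (rule subgroup.m_inv_closed[OF L m])
      have "\<phi> (inv\<^bsub>G\<^esub> m) i' = j'"
        using orbit_sym_aux[OF LG[OF m] j'E mi] .
      then have "adj j' (\<phi> (inv\<^bsub>G\<^esub> m) i)"
        using inv[OF LG[OF im] i' iE sym[OF adj]] by simp
      then have "\<phi> (inv\<^bsub>G\<^esub> m) i \<in> ?X j'"
        using element_image[OF LG[OF im] iE refl] by simp
      \<comment> \<open>Pulled back by \<open>m\<close>, the point \<open>i\<close> is a neighbour
        of \<open>j'\<close>. Whatever fixes all neighbours of \<open>j'\<close> fixes this one,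
        whose stabilizer is conjugate within \<open>L\<close> to that of \<open>i\<close>.\<close>
      then have "{s \<in> ?S j'. \<forall>x\<in>?X j'. \<phi> s x = x} \<subseteq> ?S (\<phi> (inv\<^bsub>G\<^esub> m) i)"
        by (auto simp: stabilizer_def)
      also have "\<dots> \<subseteq> L"
        by (rule stabilizer_image_subset[OF L im iE iL])
      finally have "?S j' \<subseteq> L"
        using UL[OF s(3) L] TL s(3) by blast
      then have "?S i' \<subseteq> L"
        using stabilizer_image_subset[OF L m j'E] mi by simp
      then show "i' \<in> ?C" using i' m s(3) mi by blast
    qed
    have "g \<in> L" if g: "g \<in> carrier G" for g
    proof -
      have j0E: "j\<^sub>0 \<in> E" using j0 JE by blast
      \<comment> \<open>Some \<open>l\<close> in \<open>L\<close> reaches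
        \<open>\<phi> g j\<^sub>0\<close> from \<open>J\<close>; inequivalence in \<open>J\<close>
        forces it to start at \<open>j\<^sub>0\<close>, so \<open>l\<close> and \<open>g\<close>
        differ by an element of the stabilizer of \<open>j\<^sub>0\<close>.\<close>
      have "\<phi> g j\<^sub>0 \<in> ?C"
        using element_image[OF g j0E refl] \<open>?C = E\<close> by simp
      then obtain l j where l: "l \<in> L" "j \<in> J" "\<phi> l j = \<phi> g j\<^sub>0" by auto
      have jE: "j \<in> E" using l JE by blast
      have "\<phi> (inv\<^bsub>G\<^esub> l) (\<phi> g j\<^sub>0) = j"
        using orbit_sym_aux[OF LG[OF l(1)] jE l(3)] .
      then have e: "\<phi> (inv\<^bsub>G\<^esub> l \<otimes> g) j\<^sub>0 = j"
        using LG[OF l(1)] g j0E by (simp add: composition_rule)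
      then have "j\<^sub>0 = j"
        using indep[OF _ j0 l(2)] LG[OF l(1)] g by blast
      then have "inv\<^bsub>G\<^esub> l \<otimes> g \<in> L"
        using e sL LG[OF l(1)] g by (auto simp: stabilizer_def)
      then have "l \<otimes> (inv\<^bsub>G\<^esub> l \<otimes> g) \<in> L"
        using subgroup.m_closed[OF L l(1)] by blast
      then show ?thesis
        using LG[OF l(1)] g by (simp add: r_inv flip: m_assoc)
    qed
    then show ?thesis using LG by blast
  qed
  moreover have "?T \<subseteq> carrier G" "finite ?T"
    using U finJ by auto
  ultimately show ?thesis
    by (intro exI[of _ ?T] conjI allI impI)
qed

end

section \<open>Polyhedral cones\<close>

text \<open>A convex set of positive dimension has no isolated points, so it lies in the closure of
  the punctured set, and closures keep the affine dimension.\<close>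

lemma aff_dim_diff_singleton:
  fixes S :: "'a::euclidean_space set"
  assumes "convex S" and "aff_dim S \<ge> 1"
  shows "aff_dim (S - {x}) = aff_dim S"
proof (rule antisym)
  show "aff_dim (S - {x}) \<le> aff_dim S"
    by (intro aff_dim_subset) blast
  have "S \<subseteq> closure (S - {x})"
  proof
    fix y assume "y \<in> S"
    show "y \<in> closure (S - {x})"
    proof (cases "y = x")
      case True
      have "aff_dim S \<noteq> 0" using assms(2) by linarith
      then have "y islimpt S"
        using \<open>y \<in> S\<close> assms(1) by (intro connected_imp_perfect_aff_dim convex_connected)
      then show ?thesis unfolding True islimpt_in_closure .
    next
      case False
      with \<open>y \<in> S\<close> have "y \<in> S - {x}" by simp
      then show ?thesis by (rule subsetD[OF closure_subset])
    qed
  qed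
  then have "aff_dim S \<le> aff_dim (closure (S - {x}))" by (rule aff_dim_subset)
  then show "aff_dim S \<le> aff_dim (S - {x})" by (simp add: closure_aff_dim)
qed

text \<open>Needed for tiles without their vertex. A facet of the punctured cone is invariant under
  positive scaling, because each of its points lies between two multiples of itself; so putting
  \<open>0\<close> back gives a face of \<open>C\<close>. The functional \<open>w\<close> makes the
  punctured cone convex and keeps \<open>0\<close> out of open segments in \<open>C\<close>.\<close>

lemma facets_of_cone_without_vertex:
  fixes C :: "'a::euclidean_space set"
  assumes C: "convex C" "cone C" "0 \<in> C" and dim: "aff_dim C \<ge> 2"
    and w: "\<And>x. x \<in> C \<Longrightarrow> x \<noteq> 0 \<Longrightarrow> w \<bullet> x > 0"
  shows "{F. F facet_of C - {0}} = (\<lambda>F. F - {0}) ` {F. F facet_of C}"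
proof -
  let ?D = "C - {0}"
  have "?D = C \<inter> {x. w \<bullet> x > 0}" using w by auto
  then have cD: "convex ?D"
    using convex_Int[OF C(1) convex_halfspace_gt] by metis
  have dimD: "aff_dim ?D = aff_dim C"
    using aff_dim_diff_singleton[OF C(1)] dim by simp
  have "F - {0} facet_of ?D" if F: "F facet_of C" for F
  proof -
    have "convex F" using F by (meson face_of_imp_convex facet_of_imp_face_of)
    moreover have dF: "aff_dim F = aff_dim C - 1" using F by (simp add: facet_of_def)
    ultimately have d: "aff_dim (F - {0}) = aff_dim F"
      using dim by (intro aff_dim_diff_singleton) auto
    have "F \<inter> ?D face_of C \<inter> ?D"
      using F cD by (intro face_of_slice facet_of_imp_face_of)
    moreover have "F \<inter> ?D = F - {0}" using facet_of_imp_subset[OF F] by blast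
    moreover have "C \<inter> ?D = ?D" by blast
    moreover have "F - {0} \<noteq> {}" using d dF dim by force
    ultimately show ?thesis
      using d dF dimD by (simp add: facet_of_def)
  qed
  moreover have "insert 0 F facet_of C" if F: "F facet_of ?D" for F
  proof -
    have face: "F face_of ?D" and "F \<noteq> {}" and dF: "aff_dim F = aff_dim C - 1"
      using F dimD by (auto simp: facet_of_def)
    have FD: "F \<subseteq> ?D" and cF: "convex F"
      using face by (auto simp: face_of_def)
    have scale: "c *\<^sub>R x \<in> F" if "x \<in> F" "c > 0" for c x
    proof (cases "c = 1")
      case True
      then show ?thesis using that by simp
    next
      case False
      \<comment> \<open>\<open>d\<close> lies on the other side of \<open>1\<close> from
        \<open>c\<close>, and \<open>u\<close> solves \<open>(1 - u) * c + u * d = 1\<close>, which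
        places \<open>x\<close> strictly between its two multiples.\<close>
      define d where "d = (if c < 1 then 2 else 1/2 :: real)"
      define u where "u = (1 - c) / (d - c)"
      have cd: "d > 0" "d \<noteq> c" "0 < u" "u < 1" using False \<open>c > 0\<close>
        by (auto simp: d_def u_def field_simps)
      have "u * (d - c) = 1 - c" using cd(2) by (simp add: u_def)
      then have "(1 - u) * c + u * d = 1" by (simp add: algebra_simps)
      then have "(1 - u) *\<^sub>R (c *\<^sub>R x) + u *\<^sub>R (d *\<^sub>R x) = x"
        by (metis scaleR_add_left scaleR_one scaleR_scaleR)
      moreover have "c *\<^sub>R x \<noteq> d *\<^sub>R x" using cd that FD by auto
      ultimately have "x \<in> open_segment (c *\<^sub>R x) (d *\<^sub>R x)"
        using cd by (auto simp: in_segment intro!: exI[of _ u])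
      moreover have "c *\<^sub>R x \<in> ?D" "d *\<^sub>R x \<in> ?D"
        using that FD cd C(2) by (auto simp: cone_def)
      ultimately show ?thesis using face_ofD[OF face] \<open>x \<in> F\<close> by blast
    qed
    have "convex (insert 0 F)"
    proof (rule convexI)
      fix x y u v :: 'a and s t :: real
      assume xy: "x \<in> insert 0 F" "y \<in> insert 0 F" and st: "0 \<le> s" "0 \<le> t" "s + t = 1"
      show "s *\<^sub>R x + t *\<^sub>R y \<in> insert 0 F"
      proof (cases "x = 0 \<or> y = 0")
        case True
        have "r *\<^sub>R z \<in> insert 0 F" if "z \<in> insert 0 F" "0 \<le> r" for r z
          using that scale by (cases "r = 0") auto
        note this[OF xy(1) st(1)] this[OF xy(2) st(2)]
        with True show ?thesis by (elim disjE[of "x = 0"]) simp_all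
      next
        case False
        with xy st convexD[OF cF] show ?thesis by blast
      qed
    qed
    moreover have "a \<in> insert 0 F \<and> b \<in> insert 0 F"
      if ab: "a \<in> C" "b \<in> C" and x: "x \<in> insert 0 F" "x \<in> open_segment a b" for a b x
    proof -
      obtain u where u: "0 < u" "u < 1" "x = (1 - u) *\<^sub>R a + u *\<^sub>R b" and "a \<noteq> b"
        using x(2) by (auto simp: in_segment)
      have nn: "w \<bullet> a \<ge> 0" "w \<bullet> b \<ge> 0" using w ab by (metis inner_zero_right less_eq_real_def)+
      have "x \<noteq> 0"
      proof
        assume "x = 0"
        then have "(1 - u) * (w \<bullet> a) + u * (w \<bullet> b) = 0"
          using u(3) by (metis inner_add_right inner_scaleR_right inner_zero_right)
        moreover have "w \<bullet> a > 0 \<or> w \<bullet> b > 0" using w ab \<open>a \<noteq> b\<close> by metis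
        ultimately show False using u nn
          by (smt (verit) mult_nonneg_nonneg mult_pos_pos)
      qed
      then have xF: "x \<in> F" using x by blast
      \<comment> \<open>If one endpoint is the vertex, the segment runs along a ray and the other
        endpoint is a positive multiple of \<open>x\<close>.\<close>
      consider "a = 0" | "b = 0" | "a \<noteq> 0" "b \<noteq> 0" by blast
      then show ?thesis
      proof cases
        case 1
        have "(1 / u) *\<^sub>R x \<in> F" by (rule scale[OF xF]) (use u(1) in simp)
        moreover have "b = (1 / u) *\<^sub>R x" using 1 u by simp
        ultimately show ?thesis using 1 by blast
      next
        case 2
        have "(1 / (1 - u)) *\<^sub>R x \<in> F" by (rule scale[OF xF]) (use u(2) in simp)
        moreover have "a = (1 / (1 - u)) *\<^sub>R x" using 2 u by simp
        ultimately show ?thesis using 2 by blast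
      next
        case 3
        then show ?thesis using face_ofD[OF face x(2)] ab xF by blast
      qed
    qed
    ultimately have "insert 0 F face_of C"
      using FD C(3) unfolding face_of_def by blast
    moreover have "aff_dim (insert 0 F) = aff_dim F"
    proof -
      have "aff_dim (insert 0 F) \<ge> 1"
        using aff_dim_subset[OF subset_insertI, of F 0] dF dim by linarith
      moreover have "insert 0 F - {0} = F" using FD by blast
      ultimately show ?thesis
        using aff_dim_diff_singleton[OF \<open>convex (insert 0 F)\<close>, of 0] by simp
    qed
    ultimately show ?thesis using dF by (simp add: facet_of_def)
  qed
  moreover have "F = insert 0 F - {0}" if "F facet_of ?D" for F
    using facet_of_imp_subset[OF that] by blast
  ultimately show ?thesis by (intro equalityI subsetI) (blast, blast)
qed

text \<open>The inequalities come from a minimal description of the full-dimensional cone, so each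
  cuts out a facet and every facet arises. They describe \<open>insert 0 D\<close> because
  \<open>D\<close> lacks the vertex when \<open>P\<close> does.\<close>

lemma polyhedral_cone_in_halfspaces:
  fixes P D :: "(real ^ 'n) set"
  assumes D: "polyhedral_cone_in P D" and P: "cone (insert 0 P)" and n: "CARD('n) \<ge> 2"
  obtains A :: "((real ^ 'n) \<times> real) set" where "finite A"
    and "\<forall>(a, b)\<in>A. a \<noteq> 0"
    and "insert 0 D = {x. \<forall>(a, b)\<in>A. a \<bullet> x \<le> b}"
    and "{F. F facet_of D} = (\<lambda>(a, b). D \<inter> {x. a \<bullet> x = b}) ` A"
    and "convex D"
proof -
  obtain Q where Q: "polytope Q" "Q \<subseteq> P" "0 \<notin> Q" and DQ: "D = P \<inter> cone hull Q"
    and dim: "aff_dim D = int CARD('n)"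
    using D unfolding polyhedral_cone_in_def by blast
  define C where "C = cone hull Q"
  have "Q \<noteq> {}" using dim n DQ by (auto simp: cone_hull_empty)
  then have 0: "0 \<in> C" unfolding C_def using cone_hull_contains_0 by blast
  have cQ: "convex Q" "compact Q" using Q polytope_imp_convex polytope_imp_compact by auto
  have cC: "convex C" "cone C" unfolding C_def using convex_cone_hull[OF cQ(1)] cone_cone_hull by auto
  have "C = conic hull Q" unfolding C_def hull_def cone_def conic_def by (simp add: Ball_def)
  then have pC: "polyhedron C" using polyhedron_conic_hull_polytope[OF Q(1)] by simp
  have "C \<subseteq> insert 0 P"
    unfolding C_def by (intro hull_minimal P) (use Q in auto)
  then have D_C: "insert 0 D = C" using DQ 0 unfolding C_def by auto
  \<comment> \<open>Separating \<open>0\<close> from the compact convex set \<open>Q\<close> gives a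
    functional positive on \<open>Q\<close>, hence at all nonzero points of the cone.\<close>
  obtain w b where wb: "b > 0" "\<And>x. x \<in> Q \<Longrightarrow> w \<bullet> x > b"
    using separating_hyperplane_closed_0[OF cQ(1) compact_imp_closed[OF cQ(2)] Q(3)] by blast
  have w: "w \<bullet> x > 0" if "x \<in> C" "x \<noteq> 0" for x
  proof -
    obtain c q where "c \<ge> 0" "q \<in> Q" "x = c *\<^sub>R q"
      using \<open>x \<in> C\<close> unfolding C_def cone_hull_expl by blast
    moreover from this have "c > 0" using \<open>x \<noteq> 0\<close> by (cases "c = 0") auto
    ultimately show ?thesis using wb by (simp add: less_trans[OF wb(1)])
  qed
  have "C - {0} = C \<inter> {x. w \<bullet> x > 0}" using w by auto
  then have "convex (C - {0})"
    using convex_Int[OF cC(1) convex_halfspace_gt] by metis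
  moreover have cases: "D = C \<or> D = C - {0}" using D_C by blast
  ultimately have cD: "convex D" using cC(1) by metis
  have "aff_dim C = int CARD('n)"
    using aff_dim_subset[OF subset_insertI, of D 0] D_C dim aff_dim_le_DIM[of C] by simp
  then have aff: "affine hull C = UNIV" using aff_dim_eq_full[of C] by simp
  obtain \<H> where H: "finite \<H>" "C = affine hull C \<inter> \<Inter>\<H>"
    and ex: "\<forall>h\<in>\<H>. \<exists>a b. a \<noteq> 0 \<and> h = {x. a \<bullet> x \<le> b}"
    and min: "\<And>\<H>'. \<H>' \<subset> \<H> \<Longrightarrow> C \<subset> affine hull C \<inter> \<Inter>\<H>'"
    using pC unfolding polyhedron_Int_affine_minimal by meson
  obtain a b where ab: "\<And>h. h \<in> \<H> \<Longrightarrow> a h \<noteq> 0 \<and> h = {x. a h \<bullet> x \<le> b h}"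
    using ex by metis
  have facet: "F facet_of C \<longleftrightarrow> (\<exists>h. h \<in> \<H> \<and> F = C \<inter> {x. a h \<bullet> x = b h})" for F
    by (rule facet_of_polyhedron_explicit[OF H ab min])
  let ?A = "(\<lambda>h. (a h, b h)) ` \<H>"
  have "C = \<Inter>\<H>" using H(2) aff by simp
  also have "\<dots> = {x. \<forall>(a, b)\<in>?A. a \<bullet> x \<le> b}"
    using ab by blast
  finally have "insert 0 D = {x. \<forall>(a, b)\<in>?A. a \<bullet> x \<le> b}"
    using D_C by simp
  moreover have "{F. F facet_of D} = (\<lambda>(a, b). D \<inter> {x. a \<bullet> x = b}) ` ?A"
  proof -
    have eq: "{F. F facet_of C} = (\<lambda>h. C \<inter> {x. a h \<bullet> x = b h}) ` \<H>"
      using facet by blast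
    show ?thesis
    proof (cases "D = C")
      case True
      then show ?thesis using eq by (simp add: image_image)
    next
      case False
      then have D: "D = C - {0}" using cases by blast
      have "{F. F facet_of C - {0}} = (\<lambda>F. F - {0}) ` {F. F facet_of C}"
        by (rule facets_of_cone_without_vertex[OF cC 0 _ w])
          (use \<open>aff_dim C = int CARD('n)\<close> n in auto)
      also have "\<dots> = (\<lambda>h. D \<inter> {x. a h \<bullet> x = b h}) ` \<H>"
        unfolding eq image_image D by (intro image_cong) auto
      finally show ?thesis unfolding D by (simp add: image_image)
    qed
  qed
  ultimately show thesis
    using that[of ?A] H(1) ab cD by auto
qed

text \<open>With no inequality tight at \<open>x\<close>, the point is interior. Otherwise all tight
  ones cut out the same facet, so near \<open>x\<close> no boundary lies strictly inside its
  halfspace and a half-ball fits into \<open>D\<close>.\<close>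

lemma polyhedral_cone_in_regular_point:
  fixes P D :: "(real ^ 'n) set"
  assumes D: "polyhedral_cone_in P D" and P: "cone (insert 0 P)" and n: "CARD('n) \<ge> 2"
    and x: "x \<in> D" "x \<noteq> 0"
    and uniq: "\<And>F F'. F facet_of D \<Longrightarrow> F' facet_of D \<Longrightarrow> x \<in> F \<Longrightarrow> x \<in> F' \<Longrightarrow> F = F'"
  shows "x \<in> interior D \<or>
    (\<exists>F a b e. F facet_of D \<and> x \<in> F \<and> a \<noteq> 0 \<and> a \<bullet> x = b \<and> 0 < e \<and>
       ball x e \<inter> {y. a \<bullet> y \<le> b} \<subseteq> D)"
proof -
  obtain A :: "((real ^ 'n) \<times> real) set" where A: "finite A" "\<forall>(a, b)\<in>A. a \<noteq> 0"
    and C: "insert 0 D = {x. \<forall>(a, b)\<in>A. a \<bullet> x \<le> b}"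
    and facets: "{F. F facet_of D} = (\<lambda>(a, b). D \<inter> {x. a \<bullet> x = b}) ` A"
    and cD: "convex D"
    by (rule polyhedral_cone_in_halfspaces[OF D P n])
  define C where "C = insert 0 D"
  have C_eq: "C = (\<Inter>(a, b)\<in>A. {x. a \<bullet> x \<le> b})" using C by (auto simp: C_def)
  have clC: "closed C" unfolding C_eq
    by (intro closed_INT ballI) (auto simp: closed_halfspace_le split: prod.splits)
  have op: "open {y. \<forall>(a, b)\<in>B. a \<bullet> y < b}" if "B \<subseteq> A" for B
  proof -
    have "{y. \<forall>(a, b)\<in>B. a \<bullet> y < b} = (\<Inter>(a, b)\<in>B. {y. a \<bullet> y < b})" by auto
    moreover have "open \<dots>"
      using finite_subset[OF that A(1)]
      by (intro open_INT ballI) (auto simp: open_halfspace_lt split: prod.splits)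
    ultimately show ?thesis by simp
  qed
  have intC: "{y. \<forall>(a, b)\<in>A. a \<bullet> y < b} \<subseteq> interior C"
    by (intro interior_maximal op) (auto simp: C_eq dest: less_imp_le)
  show ?thesis
  proof (cases "\<exists>(a, b)\<in>A. a \<bullet> x = b")
    case False
    then have "x \<in> {y. \<forall>(a, b)\<in>A. a \<bullet> y < b} - {0}"
      using x C by (force simp: C_def)
    moreover have "open ({y. \<forall>(a, b)\<in>A. a \<bullet> y < b} - {0})"
      using op[of A] by (simp add: open_delete)
    moreover have "{y. \<forall>(a, b)\<in>A. a \<bullet> y < b} - {0} \<subseteq> D"
      using intC interior_subset[of C] by (auto simp: C_def)
    ultimately show ?thesis
      using interiorI[of "{y. \<forall>(a, b)\<in>A. a \<bullet> y < b} - {0}" x D] by simp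
  next
    case True
    then obtain a b where ab: "(a, b) \<in> A" "a \<bullet> x = b" by blast
    have a0: "a \<noteq> 0" using A(2) ab(1) by blast
    \<comment> \<open>On \<open>U\<close> the inequalities strict at \<open>x\<close> stay strict,
      and the vertex is excluded, so that \<open>C\<close> and \<open>D\<close> agree there.\<close>
    define U where "U = {y. \<forall>(a, b)\<in>{(a, b) \<in> A. a \<bullet> x < b}. a \<bullet> y < b} - {0}"
    have "open U" unfolding U_def by (intro open_delete op) auto
    moreover have "x \<in> U" using x by (auto simp: U_def)
    ultimately obtain e where e: "e > 0" "ball x e \<subseteq> U" using open_contains_ball by blast
    let ?T = "ball x e \<inter> {y. a \<bullet> y < b}"
    have F: "D \<inter> {x. a \<bullet> x = b} facet_of D" using facets ab(1) by blast
    have DH: "D \<subseteq> {y. a \<bullet> y \<le> b}" using C ab(1) by blast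
    \<comment> \<open>A boundary point would make tight some inequality that is also tight at
      \<open>x\<close>; by \<open>uniq\<close> it defines the same facet, which puts
      \<open>z\<close> on the hyperplane.\<close>
    have "z \<notin> frontier C" if z: "z \<in> ?T" for z
    proof
      assume "z \<in> frontier C"
      then have zC: "z \<in> C" "z \<notin> interior C" using clC by (auto simp: frontier_def)
      then obtain a' b' where ab': "(a', b') \<in> A" "\<not> a' \<bullet> z < b'" using intC by blast
      have zU: "z \<in> U" using z e by blast
      then have "\<not> a' \<bullet> x < b'" using ab' by (auto simp: U_def)
      then have "a' \<bullet> x = b'" using x ab' C by force
      moreover have "a' \<bullet> z = b'" using ab' zC C_eq by force
      moreover have "D \<inter> {x. a' \<bullet> x = b'} facet_of D" using facets ab'(1) by blast
      moreover have "z \<in> D" using zC zU by (auto simp: C_def U_def)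
      ultimately have "a \<bullet> z = b"
        using uniq[OF F, of "D \<inter> {x. a' \<bullet> x = b'}"] x(1) ab(2) by blast
      then show False using z by simp
    qed
    then have "?T \<inter> frontier C = {}" by blast
    moreover have "connected ?T"
      by (intro convex_connected convex_Int convex_ball convex_halfspace_lt)
    moreover have "?T \<inter> C \<noteq> {}"
    proof -
      \<comment> \<open>Interior points of the full-dimensional convex \<open>D\<close> accumulate
        at \<open>x\<close> and lie strictly inside the halfspace.\<close>
      have "aff_dim D = int DIM(real ^ 'n)" using D by (simp add: polyhedral_cone_in_def)
      then have "interior D = rel_interior D" by (simp add: interior_rel_interior_gen)
      then have "interior D \<noteq> {}" using rel_interior_eq_empty[OF cD] x(1) by auto
      then have "x \<in> closure (interior D)"
        using convex_closure_interior[OF cD] subsetD[OF closure_subset x(1)] by simp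
      then obtain y where "y \<in> interior D" "dist y x < e"
        using e(1) closure_approachable[of x "interior D"] by blast
      moreover have "interior D \<subseteq> {y. a \<bullet> y < b}"
        using interior_mono[OF DH] a0 by simp
      ultimately have "y \<in> ?T" "y \<in> C"
        using interior_subset[of D] by (auto simp: dist_commute C_def)
      then show ?thesis by blast
    qed
    ultimately have TC: "?T \<subseteq> C"
      using connected_Int_frontier[of ?T C] by blast
    \<comment> \<open>The closure recovers the part of the half-ball on the hyperplane.\<close>
    have "ball x e \<inter> {y. a \<bullet> y \<le> b} \<subseteq> closure ?T"
      using open_Int_closure_subset[OF open_ball, of x e "{y. a \<bullet> y < b}"] a0
      by simp
    also have "\<dots> \<subseteq> C" using TC clC by (rule closure_minimal)
    finally have "ball x e \<inter> {y. a \<bullet> y \<le> b} \<subseteq> D"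
      using e(2) by (auto simp: C_def U_def)
    then show ?thesis using F x(1) ab a0 e(1) by blast
  qed
qed

section \<open>Connectedness of the adjacency graph\<close>

lemma negligible_aff_dim:
  fixes S :: "'a::euclidean_space set"
  assumes "aff_dim S < int DIM('a)"
  shows "negligible S"
proof -
  obtain a b where "a \<noteq> 0" "S \<subseteq> {x. a \<bullet> x = b}"
    using aff_lowdim_subset_hyperplane[OF assms] by metis
  then show ?thesis
    using negligible_hyperplane negligible_subset by metis
qed

text \<open>For \<open>y\<close> outside the affine hulls of \<open>insert x E\<close>, the segment from \<open>x\<close> to \<open>y\<close> avoids \<open>E\<close> after \<open>x\<close>.\<close>

lemma negligible_ball_diff_of_codim_2:
  fixes u v :: "'a::euclidean_space set"
  assumes "open u" "open v" "u \<inter> v = {}"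
    and \<E>: "countable \<E>" "\<And>E. E \<in> \<E> \<Longrightarrow> aff_dim E \<le> int DIM('a) - 2"
    and cover: "ball z e - \<Union>\<E> \<subseteq> u \<union> v"
    and x: "x \<in> ball z e" "x \<in> u"
  shows "negligible (ball z e - u)"
proof -
  let ?N = "\<Union>E\<in>\<E>. affine hull (insert x E)"
  have "negligible ?N"
  proof (intro negligible_countable_Union)
    fix S assume "S \<in> (\<lambda>E. affine hull insert x E) ` \<E>"
    then obtain E where "E \<in> \<E>" "S = affine hull insert x E" by blast
    then have "aff_dim S < int DIM('a)" using \<E>(2)[of E] by (simp add: aff_dim_insert)
    then show "negligible S" by (rule negligible_aff_dim)
  qed (use \<E>(1) in simp)
  moreover have "ball z e - u \<subseteq> ?N"
  proof
    fix y assume y: "y \<in> ball z e - u"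
    show "y \<in> ?N"
    proof (rule ccontr)
      assume yN: "y \<notin> ?N"
      have "closed_segment x y \<subseteq> u \<union> v"
      proof
        fix p assume p: "p \<in> closed_segment x y"
        have pB: "p \<in> ball z e"
          using closed_segment_subset[OF x(1) _ convex_ball] y p by blast
        show "p \<in> u \<union> v"
        proof (rule ccontr)
          assume "p \<notin> u \<union> v"
          then obtain E where E: "E \<in> \<E>" "p \<in> E" using cover pB by blast
          have "p \<noteq> x" using \<open>p \<notin> u \<union> v\<close> x by blast
          obtain t where t: "p = (1 - t) *\<^sub>R x + t *\<^sub>R y" using p by (auto simp: in_segment)
          then have "t \<noteq> 0" using \<open>p \<noteq> x\<close> by auto
          \<comment> \<open>\<open>y\<close> is recovered on the line through \<open>x\<close> and
            the point \<open>p\<close> of \<open>E\<close>.\<close>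
          have "(1 - 1/t) *\<^sub>R x + (1/t) *\<^sub>R p = y"
            using \<open>t \<noteq> 0\<close> by (simp add: t algebra_simps)
          moreover have "(1 - 1/t) *\<^sub>R x + (1/t) *\<^sub>R p \<in> affine hull (insert x E)"
            using E by (intro mem_affine) (auto intro: hull_inc)
          ultimately show False using yN E(1) by auto
        qed
      qed
      moreover have "u \<inter> v \<inter> closed_segment x y = {}" using assms(3) by blast
      ultimately have "u \<inter> closed_segment x y = {} \<or> v \<inter> closed_segment x y = {}"
        using connectedD[OF connected_segment(1) assms(1,2)] by blast
      then have "v \<inter> closed_segment x y = {}" using x(2) by auto
      then have "y \<in> u"
        using \<open>closed_segment x y \<subseteq> u \<union> v\<close> ends_in_segment(2)[of y x] by blast
      then show False using y by blast
    qed
  qed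
  ultimately show ?thesis by (rule negligible_subset)
qed

text \<open>Almost all of any ball in \<open>W\<close> that meets \<open>u\<close> lies in
  \<open>u\<close>, and likewise for \<open>v\<close>. So enlarging both to the unions of such balls
  keeps them disjoint in \<open>W\<close>: an overlap would be a nonempty open null set. The
  enlarged sets cover \<open>W\<close>, because no ball lies within a null set.\<close>

lemma connected_open_minus_codim_2:
  fixes W u v :: "'a::euclidean_space set"
  assumes W: "open W" "connected W" and uv: "open u" "open v" "u \<inter> v = {}"
    and \<E>: "countable \<E>" "\<And>E. E \<in> \<E> \<Longrightarrow> aff_dim E \<le> int DIM('a) - 2"
    and cover: "W - \<Union>\<E> \<subseteq> u \<union> v"
  shows "W \<inter> u = {} \<or> W \<inter> v = {}"
proof -
  define N where "N s = (\<Union>(z, e)\<in>{(z, e). ball z e \<subseteq> W \<and> ball z e \<inter> s \<noteq> {}}. ball z e)"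
    for s :: "'a set"
  have opN: "open (N s)" for s unfolding N_def by (intro open_UN) auto
  have N_iff: "p \<in> N s \<longleftrightarrow> (\<exists>z e. ball z e \<subseteq> W \<and> ball z e \<inter> s \<noteq> {} \<and> p \<in> ball z e)" for p s
    unfolding N_def by (simp only: UN_iff Bex_def split_paired_Ex mem_Collect_eq case_prod_conv) blast
  have ball_ne: "\<not> negligible (ball p e)" if "e > 0" for p :: 'a and e
    using open_not_negligible[OF open_ball, of p e] that by simp
  have neg: "negligible (\<Union>\<E>)"
  proof (rule negligible_countable_Union[OF \<E>(1)])
    show "negligible E" if "E \<in> \<E>" for E
      using \<E>(2)[OF that] by (intro negligible_aff_dim) simp
  qed
  have "W \<subseteq> N u \<union> N v"
  proof
    fix p assume "p \<in> W"
    then obtain e where e: "e > 0" "ball p e \<subseteq> W" using W(1) open_contains_ball by blast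
    then have "\<not> ball p e \<subseteq> \<Union>\<E>"
      using ball_ne[OF e(1)] negligible_subset[OF neg] by blast
    then have "ball p e \<inter> u \<noteq> {} \<or> ball p e \<inter> v \<noteq> {}" using cover e(2) by blast
    moreover have "p \<in> ball p e" using e(1) by simp
    ultimately show "p \<in> N u \<union> N v"
      unfolding Un_iff N_iff using e(2) by metis
  qed
  moreover have "N u \<inter> N v \<inter> W = {}"
  proof (rule ccontr)
    assume "N u \<inter> N v \<inter> W \<noteq> {}"
    then obtain p z\<^sub>1 e\<^sub>1 z\<^sub>2 e\<^sub>2 where p: "p \<in> ball z\<^sub>1 e\<^sub>1" "p \<in> ball z\<^sub>2 e\<^sub>2"
      and B: "ball z\<^sub>1 e\<^sub>1 \<subseteq> W" "ball z\<^sub>2 e\<^sub>2 \<subseteq> W"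
      and "ball z\<^sub>1 e\<^sub>1 \<inter> u \<noteq> {}" "ball z\<^sub>2 e\<^sub>2 \<inter> v \<noteq> {}"
      unfolding Int_iff N_iff ex_in_conv[symmetric] by metis
    then obtain x y where x: "x \<in> ball z\<^sub>1 e\<^sub>1" "x \<in> u" and y: "y \<in> ball z\<^sub>2 e\<^sub>2" "y \<in> v"
      by blast
    have "negligible (ball z\<^sub>1 e\<^sub>1 - u)"
      by (rule negligible_ball_diff_of_codim_2[OF uv \<E> _ x]) (use cover B in blast)+
    moreover have "v \<inter> u = {}" "ball z\<^sub>2 e\<^sub>2 - \<Union>\<E> \<subseteq> v \<union> u" using uv(3) cover B by blast+
    then have "negligible (ball z\<^sub>2 e\<^sub>2 - v)"
      by (intro negligible_ball_diff_of_codim_2[OF uv(2,1) _ \<E> _ y])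
    ultimately have "negligible ((ball z\<^sub>1 e\<^sub>1 - u) \<union> (ball z\<^sub>2 e\<^sub>2 - v))"
      by (rule negligible_Un)
    moreover have "ball z\<^sub>1 e\<^sub>1 \<inter> ball z\<^sub>2 e\<^sub>2 \<subseteq> (ball z\<^sub>1 e\<^sub>1 - u) \<union> (ball z\<^sub>2 e\<^sub>2 - v)"
      using uv(3) by blast
    ultimately have "negligible (ball z\<^sub>1 e\<^sub>1 \<inter> ball z\<^sub>2 e\<^sub>2)" by (rule negligible_subset)
    moreover have "open (ball z\<^sub>1 e\<^sub>1 \<inter> ball z\<^sub>2 e\<^sub>2)" by auto
    moreover have "ball z\<^sub>1 e\<^sub>1 \<inter> ball z\<^sub>2 e\<^sub>2 \<noteq> {}" using p by blast
    ultimately show False using open_not_negligible[of "ball z\<^sub>1 e\<^sub>1 \<inter> ball z\<^sub>2 e\<^sub>2"] by simp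
  qed
  ultimately have "N u \<inter> W = {} \<or> N v \<inter> W = {}"
    using connectedD[OF W(2) opN opN, of u v] by blast
  moreover have "W \<inter> s \<subseteq> N s" for s
  proof
    fix p assume p: "p \<in> W \<inter> s"
    then obtain e where e: "e > 0" "ball p e \<subseteq> W" using W(1) open_contains_ball by blast
    moreover have "p \<in> ball p e" using e(1) by simp
    moreover from this have "ball p e \<inter> s \<noteq> {}" using p by blast
    ultimately show "p \<in> N s" unfolding N_iff by metis
  qed
  ultimately show ?thesis by blast
qed

text \<open>Every element is the value of a word in \<open>S\<close> and its inverses. This makes
  the tiles countable, hence the union of their lower-dimensional intersections negligible.\<close>

lemma (in group) countable_generate:
  assumes "countable S" and "S \<subseteq> carrier G"
  shows "countable (generate G S)"
proof -
  let ?w = "\<lambda>l. foldr (\<otimes>) l \<one>"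
  let ?L = "lists (S \<union> m_inv G ` S)"
  have L: "set l \<subseteq> carrier G" if "l \<in> ?L" for l
    using that assms(2) by (auto simp: in_lists_conv_set)
  have w: "?w l \<in> carrier G" if "set l \<subseteq> carrier G" for l
    using that by (induction l) auto
  have append: "?w (l @ l') = ?w l \<otimes> ?w l'" if "set l \<subseteq> carrier G" "set l' \<subseteq> carrier G" for l l'
    using that by (induction l) (auto simp: w m_assoc)
  have "g \<in> ?w ` ?L" if "g \<in> generate G S" for g
    using that
  proof (induction rule: generate.induct)
    case one
    show ?case by (rule image_eqI[of _ _ "[]"]) auto
  next
    case (incl h)
    then show ?case using assms(2) by (intro image_eqI[of _ _ "[h]"]) auto
  next
    case (inv h)
    then show ?case using assms(2) by (intro image_eqI[of _ _ "[inv h]"]) auto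
  next
    case (eng h1 h2)
    then obtain l1 l2 where l: "l1 \<in> ?L" "h1 = ?w l1" "l2 \<in> ?L" "h2 = ?w l2" by blast
    then have "h1 \<otimes> h2 = ?w (l1 @ l2)" using append L by simp
    then show ?case using l by (intro image_eqI[of _ _ "l1 @ l2"]) auto
  qed
  then have "generate G S \<subseteq> ?w ` ?L" by blast
  moreover have "countable (?w ` ?L)"
    using assms(1) by (intro countable_image countable_lists) auto
  ultimately show ?thesis by (rule countable_subset)
qed

section \<open>Tiles, their facets and their neighbours\<close>

context exact_tessellation
begin

lemma aff_dim_tile: "i \<in> I \<Longrightarrow> aff_dim (D i) = int CARD('n)"
  using tile by (simp add: polyhedral_cone_in_def)

lemma tile_subset: "i \<in> I \<Longrightarrow> D i \<subseteq> P"
  using tile by (auto simp: polyhedral_cone_in_def)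

lemma convex_tile: "i \<in> I \<Longrightarrow> convex (D i)"
  using polyhedral_cone_in_halfspaces[OF tile cone_P dim_ge_2] by metis

lemma finite_facets:
  assumes "i \<in> I"
  shows "finite {F. F facet_of D i}"
  by (rule polyhedral_cone_in_halfspaces[OF tile[OF assms] cone_P dim_ge_2]) simp

lemma interior_tile: "i \<in> I \<Longrightarrow> interior (D i) \<noteq> {}"
  using aff_dim_tile[of i] rel_interior_eq_empty[OF convex_tile, of i] dim_ge_2
  by (auto simp: interior_rel_interior_gen)

lemma aff_dim_tile_Int:
  assumes "i \<in> I" "i' \<in> I" "i \<noteq> i'"
  shows "aff_dim (D i \<inter> D i') \<le> int CARD('n) - 1"
  using face_to_face[OF assms(1,2)] assms(3) dim_ge_2 by auto

lemma inj_on_tile: "inj_on D I"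
proof (rule inj_onI, rule ccontr)
  fix i i' assume "i \<in> I" "i' \<in> I" "D i = D i'" "i \<noteq> i'"
  then show False using aff_dim_tile_Int[of i i'] aff_dim_tile[of i] by simp
qed

text \<open>\<open>face_to_face\<close> already makes the intersection a face of both tiles, so only
  its dimension matters; this form suits homeomorphisms.\<close>

lemma adjacent_iff:
  assumes "i \<in> I" "i' \<in> I"
  shows "adjacent D i i' \<longleftrightarrow> i \<noteq> i' \<and> aff_dim (D i \<inter> D i') = int CARD('n) - 1"
proof
  assume "adjacent D i i'"
  then show "i \<noteq> i' \<and> aff_dim (D i \<inter> D i') = int CARD('n) - 1"
    using aff_dim_tile[OF assms(1)] by (auto simp: adjacent_def facet_of_def)
next
  assume a: "i \<noteq> i' \<and> aff_dim (D i \<inter> D i') = int CARD('n) - 1"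
  then have "D i \<inter> D i' \<noteq> {}" using dim_ge_2 by (intro notI) simp
  then show "adjacent D i i'"
    using a face_to_face[OF assms] aff_dim_tile assms by (auto simp: adjacent_def facet_of_def)
qed

lemma adjacent_sym: "adjacent D i i' \<Longrightarrow> adjacent D i' i"
  by (auto simp: adjacent_def Int_commute)

text \<open>\<open>unique_neighbour\<close> does not itself say that the other tile differs from
  \<open>D i\<close>; the dimensions do.\<close>

lemma facet_neighbour:
  assumes i: "i \<in> I" and F: "F facet_of D i"
  obtains i' where "i' \<in> I" "adjacent D i i'" "D i \<inter> D i' = F"
proof -
  obtain i' where i': "i' \<in> I" "D i \<inter> D i' = F"
    using unique_neighbour[OF i F] by blast
  have dF: "aff_dim F = int CARD('n) - 1"
    using F aff_dim_tile[OF i] by (simp add: facet_of_def)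
  then have "i \<noteq> i'" using i'(2) aff_dim_tile[OF i] by auto
  then show thesis using that i' dF adjacent_iff[OF i i'(1)] by simp
qed

lemma bij_betw_facets:
  assumes i: "i \<in> I"
  shows "bij_betw (\<lambda>i'. D i \<inter> D i') {i' \<in> I. adjacent D i i'} {F. F facet_of D i}"
proof (rule bij_betwI')
  fix x y assume x: "x \<in> {i' \<in> I. adjacent D i i'}" and y: "y \<in> {i' \<in> I. adjacent D i i'}"
  then have "D i \<inter> D x facet_of D i" by (simp add: adjacent_def)
  from unique_neighbour[OF i this] show "(D i \<inter> D x = D i \<inter> D y) = (x = y)"
    using x y by blast
next
  fix x assume "x \<in> {i' \<in> I. adjacent D i i'}"
  then show "D i \<inter> D x \<in> {F. F facet_of D i}" by (simp add: adjacent_def)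
next
  fix F assume "F \<in> {F. F facet_of D i}"
  then show "\<exists>x\<in>{i' \<in> I. adjacent D i i'}. F = D i \<inter> D x"
    using facet_neighbour[OF i, of F] by blast
qed

text \<open>A facet inside another one would be a proper face of it with the same dimension. So the
  intersection is a proper face of \<open>F\<close>.\<close>

lemma aff_dim_facet_Int:
  assumes i: "i \<in> I" and F: "F facet_of D i" "F' facet_of D i" and "F \<noteq> F'"
  shows "aff_dim (F \<inter> F') \<le> int CARD('n) - 2"
proof -
  have face: "F face_of D i" "F' face_of D i" and
    dim: "aff_dim F = int CARD('n) - 1" "aff_dim F' = int CARD('n) - 1"
    using F aff_dim_tile[OF i] by (auto simp: facet_of_def)
  have sub: "F \<subseteq> D i" "F' \<subseteq> D i" using face face_of_imp_subset by auto
  have cF: "convex F" "convex F'" using face face_of_imp_convex by auto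
  have ne: "F \<inter> F' \<noteq> F"
  proof
    assume "F \<inter> F' = F"
    then have "F \<subseteq> F'" by blast
    then have "F face_of F'" using face_of_subset[OF face(1)] sub by blast
    then show False using face_of_aff_dim_lt[OF cF(2)] \<open>F \<noteq> F'\<close> dim by fastforce
  qed
  have "F \<inter> F' face_of D i" using face by (rule face_of_Int)
  then have "F \<inter> F' face_of F" using face_of_subset sub by blast
  then have "aff_dim (F \<inter> F') < aff_dim F" using ne by (rule face_of_aff_dim_lt[OF cF(1)])
  then show ?thesis using dim by simp
qed

lemma cover_tiles: "P = (\<Union>i\<in>I. D i)" if "i\<^sub>0 \<in> I"
proof -
  have "\<phi> g ` D i\<^sub>0 \<subseteq> (\<Union>i\<in>I. D i)" if "g \<in> carrier G" for g
    using tiles_invariant[OF that \<open>i\<^sub>0 \<in> I\<close>] by auto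
  then have "P \<subseteq> (\<Union>i\<in>I. D i)" using cover[OF that] by blast
  then show ?thesis using tile_subset by blast
qed

text \<open>Makes a point on a common facet interior to the union of the two tiles, although the two
  bounding hyperplanes are not known to coincide.\<close>

lemma ball_in_two_tiles:
  assumes i: "i \<in> I" "i' \<in> I" "i \<noteq> i'"
    and h: "a \<bullet> x = b" "0 < e" "ball x e \<inter> {y. a \<bullet> y \<le> b} \<subseteq> D i"
    and h': "a' \<bullet> x = b'" "0 < e'" "ball x e' \<inter> {y. a' \<bullet> y \<le> b'} \<subseteq> D i'"
  shows "ball x (min e e') \<subseteq> D i \<union> D i'"
proof
  fix y assume y: "y \<in> ball x (min e e')"
  show "y \<in> D i \<union> D i'"
  proof (rule ccontr)
    assume "y \<notin> D i \<union> D i'"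
    then have gt: "a \<bullet> y > b" "a' \<bullet> y > b'" using y h h' by force+
    let ?O = "ball x (min e e') \<inter> ({z. a \<bullet> z < b} \<inter> {z. a' \<bullet> z < b'})"
    have op: "open ?O" by (intro open_Int open_ball open_halfspace_lt)
    \<comment> \<open>The reflection of \<open>y\<close> in \<open>x\<close> would be an interior point of both tiles.\<close>
    define z where "z = x + (x - y)"
    have "c \<bullet> z = c \<bullet> x + (c \<bullet> x - c \<bullet> y)" for c
      unfolding z_def inner_add_right inner_diff_right ..
    moreover have "dist x z = dist x y" by (simp add: z_def dist_norm norm_minus_commute)
    ultimately have "z \<in> ?O" using y gt h(1) h'(1) by simp
    then have "aff_dim ?O = int CARD('n)" using aff_dim_open[OF op] by fastforce
    moreover have "?O \<subseteq> D i \<inter> D i'" using h(3) h'(3) by force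
    ultimately show False using aff_dim_subset[of ?O "D i \<inter> D i'"] aff_dim_tile_Int[OF i] by simp
  qed
qed

lemma countable_tiles:
  assumes "finitely_generated G" and "i\<^sub>0 \<in> I"
  shows "countable I"
proof -
  interpret group G using group_hom group_hom.axioms(1) by auto
  obtain S where "finite S" "S \<subseteq> carrier G" "generate G S = carrier G"
    using assms(1) by (auto simp: finitely_generated_def)
  then have "countable (carrier G)" using countable_generate[of S] by (simp add: countable_finite)
  moreover have "D ` I \<subseteq> (\<lambda>g. \<phi> g ` D i\<^sub>0) ` carrier G"
  proof
    fix T assume "T \<in> D ` I"
    then obtain i where "i \<in> I" "T = D i" by blast
    then show "T \<in> (\<lambda>g. \<phi> g ` D i\<^sub>0) ` carrier G"
      using tiles_transitive[OF assms(2), of i] by blast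
  qed
  ultimately have "countable (D ` I)" by (meson countable_image countable_subset)
  then show ?thesis by (rule countable_image_inj_on[OF _ inj_on_tile])
qed

text \<open>Outside a set of codimension two, a point of \<open>interior P\<close> is interior to a
  tile or lies on a facet between two tiles, both in \<open>C\<close> or both outside. So the
  interiors of the two unions of tiles are disjoint open sets covering the rest of
  \<open>interior P\<close>, and connectedness leaves only one of them.\<close>

theorem adjacency_connected:
  assumes fg: "finitely_generated G" and "C \<subseteq> I" and "C \<noteq> {}"
    and closed: "\<And>i i'. i \<in> C \<Longrightarrow> i' \<in> I \<Longrightarrow> adjacent D i i' \<Longrightarrow> i' \<in> C"
  shows "C = I"
proof -
  obtain i\<^sub>0 where "i\<^sub>0 \<in> C" "i\<^sub>0 \<in> I" using assms by blast
  have cI: "countable I" using countable_tiles[OF fg \<open>i\<^sub>0 \<in> I\<close>] .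
  define U where "U = (\<Union>i\<in>C. D i)"
  define V where "V = (\<Union>i\<in>I - C. D i)"
  \<comment> \<open>The points where the local description of a tile may fail: those on two of its
    facets, and the vertex. \<open>{0}\<close> has codimension at least two by
    \<open>dim_ge_2\<close>.\<close>
  define \<E> where "\<E> = insert {0} (\<Union>i\<in>I. (\<lambda>(F, F'). F \<inter> F') `
    {(F, F'). F facet_of D i \<and> F' facet_of D i \<and> F \<noteq> F'})"
  have "countable \<E>"
  proof -
    have "finite {(F, F'). F facet_of D i \<and> F' facet_of D i \<and> F \<noteq> F'}" if "i \<in> I" for i
      by (rule finite_subset[of _ "{F. F facet_of D i} \<times> {F. F facet_of D i}"])
        (use finite_facets[OF that] in auto)
    then show ?thesis
      unfolding \<E>_def by (intro countable_insert countable_UN[OF cI] countable_finite finite_imageI)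
  qed
  moreover have "aff_dim E \<le> int DIM(real ^ 'n) - 2" if "E \<in> \<E>" for E
    using that aff_dim_facet_Int dim_ge_2 by (auto simp: \<E>_def)
  moreover have "interior U \<inter> interior V = {}"
  proof -
    \<comment> \<open>Common points of \<open>U\<close> and \<open>V\<close> lie in countably many
      null intersections of tiles, and an open null set is empty.\<close>
    have "negligible (\<Union>p\<in>C \<times> (I - C). D (fst p) \<inter> D (snd p))"
    proof (intro negligible_countable_Union)
      show "countable ((\<lambda>p. D (fst p) \<inter> D (snd p)) ` (C \<times> (I - C)))"
        using cI \<open>C \<subseteq> I\<close> by (intro countable_image countable_SIGMA) (auto intro: countable_subset)
      fix S assume "S \<in> (\<lambda>p. D (fst p) \<inter> D (snd p)) ` (C \<times> (I - C))"
      then obtain i i' where "i \<in> C" "i' \<in> I - C" "S = D i \<inter> D i'" by auto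
      then have "aff_dim S < int DIM(real ^ 'n)"
        using aff_dim_tile_Int[of i i'] \<open>C \<subseteq> I\<close> by force
      then show "negligible S" by (rule negligible_aff_dim)
    qed
    moreover have "interior U \<inter> interior V \<subseteq> (\<Union>p\<in>C \<times> (I - C). D (fst p) \<inter> D (snd p))"
      using interior_subset[of U] interior_subset[of V] by (fastforce simp: U_def V_def)
    ultimately have "negligible (interior U \<inter> interior V)" by (rule negligible_subset)
    then show ?thesis using open_not_negligible[of "interior U \<inter> interior V"] by auto
  qed
  moreover have "interior P - \<Union>\<E> \<subseteq> interior U \<union> interior V"
  proof
    fix x assume "x \<in> interior P - \<Union>\<E>"
    then have xP: "x \<in> P" and x\<E>: "x \<notin> \<Union>\<E>" using interior_subset by auto
    then obtain i where i: "i \<in> I" "x \<in> D i" using cover_tiles[OF \<open>i\<^sub>0 \<in> I\<close>] by blast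
    have regular: "x \<in> interior (D j) \<or>
      (\<exists>F a b e. F facet_of D j \<and> x \<in> F \<and> a \<noteq> 0 \<and> a \<bullet> x = b \<and> 0 < e \<and>
         ball x e \<inter> {y. a \<bullet> y \<le> b} \<subseteq> D j)" if "j \<in> I" "x \<in> D j" for j
    proof (rule polyhedral_cone_in_regular_point[OF tile[OF that(1)] cone_P dim_ge_2 that(2)])
      show "x \<noteq> 0" using x\<E> by (auto simp: \<E>_def)
      show "F = F'" if "F facet_of D j" "F' facet_of D j" "x \<in> F" "x \<in> F'" for F F'
        using x\<E> that \<open>j \<in> I\<close> by (force simp: \<E>_def)
    qed
    have int: "x \<in> interior U \<union> interior V" if "j \<in> I" "x \<in> interior (D j)" for j
    proof -
      have "D j \<subseteq> U \<or> D j \<subseteq> V" using \<open>j \<in> I\<close> by (auto simp: U_def V_def)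
      then show ?thesis using interior_mono[of "D j"] that(2) by blast
    qed
    show "x \<in> interior U \<union> interior V"
      using regular[OF i]
    proof (elim disjE exE conjE)
      assume "x \<in> interior (D i)"
      then show ?thesis by (rule int[OF i(1)])
    next
      fix F a b e
      assume F: "F facet_of D i" "x \<in> F" and h: "a \<bullet> x = b" "0 < e" "ball x e \<inter> {y. a \<bullet> y \<le> b} \<subseteq> D i"
      obtain i' where i': "i' \<in> I" "adjacent D i i'" "D i \<inter> D i' = F"
        by (rule facet_neighbour[OF i(1) F(1)])
      then have "x \<in> D i'" "i \<noteq> i'" using F(2) by (auto simp: adjacent_def)
      show ?thesis
        using regular[OF i'(1) \<open>x \<in> D i'\<close>]
      proof (elim disjE exE conjE)
        assume "x \<in> interior (D i')"
        then show ?thesis by (rule int[OF i'(1)])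
      next
        fix a' b' e'
        assume h': "a' \<bullet> x = b'" "0 < e'" "ball x e' \<inter> {y. a' \<bullet> y \<le> b'} \<subseteq> D i'"
        have "ball x (min e e') \<subseteq> D i \<union> D i'"
          by (rule ball_in_two_tiles[OF i(1) i'(1) \<open>i \<noteq> i'\<close> h h'])
        then have "x \<in> interior (D i \<union> D i')"
          using h(2) h'(2) by (auto simp: mem_interior intro!: exI[of _ "min e e'"])
        \<comment> \<open>By symmetry of adjacency, \<open>I - C\<close> is closed as well.\<close>
        moreover have "D i \<union> D i' \<subseteq> U \<or> D i \<union> D i' \<subseteq> V"
          using closed[OF _ i'(1,2)] closed[OF _ i(1) adjacent_sym[OF i'(2)]] i(1) i'(1)
          unfolding U_def V_def by blast
        ultimately show ?thesis using interior_mono[of "D i \<union> D i'"] by blast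
      qed
    qed
  qed
  ultimately have dich: "interior P \<inter> interior U = {} \<or> interior P \<inter> interior V = {}"
    by (intro connected_open_minus_codim_2[OF open_interior connected_interior_P open_interior open_interior])
  have meets: "interior P \<inter> interior S \<noteq> {}" if "i \<in> I" "D i \<subseteq> S" for i S
    using interior_mono[OF tile_subset[OF that(1)]] interior_mono[OF that(2)] interior_tile[OF that(1)]
    by blast
  have "D i\<^sub>0 \<subseteq> U" using \<open>i\<^sub>0 \<in> C\<close> by (auto simp: U_def)
  then have "interior P \<inter> interior V = {}"
    using dich meets[OF \<open>i\<^sub>0 \<in> I\<close>] by blast
  moreover have "D i \<subseteq> V" if "i \<in> I - C" for i using that by (auto simp: V_def)
  ultimately show ?thesis using meets \<open>C \<subseteq> I\<close> by blast
qed

end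

section \<open>The action on the tiles\<close>

lemma min_generators_le:
  assumes "finite S" "S \<subseteq> carrier G" "generate G S = carrier G"
  shows "min_generators G \<le> card S"
  unfolding min_generators_def using assms by (intro Least_le exI[of _ S]) simp

lemma min_generators_attained:
  assumes "finitely_generated G"
  obtains S where "finite S" "S \<subseteq> carrier G" "generate G S = carrier G" "card S = min_generators G"
proof -
  have "\<exists>n S. finite S \<and> S \<subseteq> carrier G \<and> generate G S = carrier G \<and> card S = n"
    using assms by (auto simp: finitely_generated_def)
  from LeastI_ex[OF this] show thesis
    using that unfolding min_generators_def by blast
qed

lemma (in group) finitely_generated_of_finite:
  assumes "finite (carrier G)"
  shows "finitely_generated G"
  unfolding finitely_generated_def
  using assms generate_incl[of "carrier G"] generate.incl[of _ "carrier G" G]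
  by (intro exI[of _ "carrier G"]) auto

text \<open>The preimage of \<open>L\<close> under conjugation; being a subgroup, it lets conjugates
  be tested for membership in \<open>L\<close> on generators alone.\<close>

lemma (in group) subgroup_conjugate_vimage:
  assumes L: "subgroup L G" and m: "m \<in> carrier G"
  shows "subgroup {x \<in> carrier G. inv m \<otimes> x \<otimes> m \<in> L} G"
proof (rule subgroupI)
  show "{x \<in> carrier G. inv m \<otimes> x \<otimes> m \<in> L} \<noteq> {}"
    using m subgroup.one_closed[OF L] by (auto intro!: exI[of _ \<one>])
  fix x assume x: "x \<in> {x \<in> carrier G. inv m \<otimes> x \<otimes> m \<in> L}"
  then have "inv (inv m \<otimes> x \<otimes> m) \<in> L" using subgroup.m_inv_closed[OF L] by blast
  moreover have "inv (inv m \<otimes> x \<otimes> m) = inv m \<otimes> inv x \<otimes> m"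
    using x m by (simp add: inv_mult_group m_assoc)
  ultimately show "inv x \<in> {x \<in> carrier G. inv m \<otimes> x \<otimes> m \<in> L}" using x by simp
  fix y assume y: "y \<in> {x \<in> carrier G. inv m \<otimes> x \<otimes> m \<in> L}"
  have "(inv m \<otimes> x \<otimes> m) \<otimes> (inv m \<otimes> y \<otimes> m) \<in> L"
    using x y subgroup.m_closed[OF L] by blast
  moreover have "(inv m \<otimes> x \<otimes> m) \<otimes> (inv m \<otimes> y \<otimes> m) = inv m \<otimes> (x \<otimes> y) \<otimes> m"
  proof -
    have "m \<otimes> (inv m \<otimes> (y \<otimes> m)) = y \<otimes> m"
      using x y m by (simp flip: m_assoc)
    then show ?thesis using x y m by (simp add: m_assoc)
  qed
  ultimately show "x \<otimes> y \<in> {x \<in> carrier G. inv m \<otimes> x \<otimes> m \<in> L}" using x y by simp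
qed auto

text \<open>One inclusion is regrouping; the other is the same with \<open>a\<close> and
  \<open>g\<close> exchanged, as \<open>a = inv h \<otimes> g \<otimes> inv k\<close>.\<close>

lemma (in group) double_coset_eq:
  assumes H: "subgroup H G" and K: "subgroup K G" and a: "a \<in> carrier G"
    and h: "h \<in> H" and k: "k \<in> K" and g: "g = h \<otimes> a \<otimes> k"
  shows "{h \<otimes> g \<otimes> k | h k. h \<in> H \<and> k \<in> K} = {h \<otimes> a \<otimes> k | h k. h \<in> H \<and> k \<in> K}"
proof -
  have sub: "{h \<otimes> g \<otimes> k | h k. h \<in> H \<and> k \<in> K} \<subseteq> {h \<otimes> a \<otimes> k | h k. h \<in> H \<and> k \<in> K}"
    if "a \<in> carrier G" "h \<in> H" "k \<in> K" "g = h \<otimes> a \<otimes> k" for a g h k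
  proof clarify
    fix h' k' assume h': "h' \<in> H" and k': "k' \<in> K"
    have "h' \<otimes> g \<otimes> k' = (h' \<otimes> h) \<otimes> a \<otimes> (k \<otimes> k')"
      using that h' k' subgroup.mem_carrier[OF H] subgroup.mem_carrier[OF K]
      by (simp add: m_assoc)
    then show "\<exists>h'' k''. h' \<otimes> g \<otimes> k' = h'' \<otimes> a \<otimes> k'' \<and> h'' \<in> H \<and> k'' \<in> K"
      using that h' k' subgroup.m_closed[OF H] subgroup.m_closed[OF K] by blast
  qed
  have hk: "h \<in> carrier G" "k \<in> carrier G"
    using h k subgroup.mem_carrier[OF H] subgroup.mem_carrier[OF K] by auto
  then have "inv h \<otimes> (h \<otimes> a \<otimes> k) \<otimes> inv k = a"
    using a by (metis inv_closed inv_solve_left inv_solve_right m_closed m_assoc)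
  then have "a = inv h \<otimes> g \<otimes> inv k" using g by simp
  moreover have "g \<in> carrier G" using g a hk by simp
  ultimately show ?thesis
    using sub[OF a h k g] sub[of g "inv h" "inv k" a]
      subgroup.m_inv_closed[OF H h] subgroup.m_inv_closed[OF K k] by blast
qed

section \<open>The induced action on tile indices\<close>

context exact_tessellation
begin

interpretation group G
  using group_hom group_hom.axioms(1) by auto

text \<open>Moves the action from tiles to indices, on which \<open>D\<close> is injective. The
  restriction to \<open>I\<close> makes the maps extensional, as \<open>Bij I\<close>
  demands.\<close>

definition tile_action :: "'g \<Rightarrow> 'i \<Rightarrow> 'i" where
  "tile_action g = (\<lambda>i\<in>I. the_inv_into I D (\<phi> g ` D i))"

lemma tile_tile_action:
  assumes "g \<in> carrier G" "i \<in> I"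
  shows "D (tile_action g i) = \<phi> g ` D i"
  using f_the_inv_into_f[OF inj_on_tile tiles_invariant[OF assms]] assms
  by (simp add: tile_action_def)

lemma tile_action_closed:
  assumes "g \<in> carrier G" "i \<in> I"
  shows "tile_action g i \<in> I"
  using the_inv_into_into[OF inj_on_tile tiles_invariant[OF assms] subset_refl] assms
  by (simp add: tile_action_def)

lemma tile_action_eq_iff:
  assumes "g \<in> carrier G" "i \<in> I" "i' \<in> I"
  shows "tile_action g i = i' \<longleftrightarrow> \<phi> g ` D i = D i'"
  using tile_tile_action[OF assms(1,2)] tile_action_closed[OF assms(1,2)]
    inj_on_eq_iff[OF inj_on_tile _ assms(3)] by metis

lemma image_mult:
  assumes "g \<in> carrier G" "h \<in> carrier G" "S \<subseteq> P"
  shows "\<phi> (g \<otimes> h) ` S = \<phi> g ` \<phi> h ` S"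
proof -
  have "\<phi> (g \<otimes> h) x = \<phi> g (\<phi> h x)" if "x \<in> S" for x
    using composition_rule[of x g h] assms that by blast
  then show ?thesis unfolding image_image by (rule image_cong[OF refl])
qed

lemma image_inv:
  assumes "g \<in> carrier G" "S \<subseteq> P"
  shows "\<phi> (inv g) ` \<phi> g ` S = S"
proof -
  have "\<phi> (inv g) (\<phi> g x) = x" if "x \<in> S" for x
    using orbit_sym_aux[OF assms(1) _ refl] assms that by blast
  then show ?thesis by (simp add: image_image)
qed

lemma tile_action_mult:
  assumes "g \<in> carrier G" "h \<in> carrier G" "i \<in> I"
  shows "tile_action (g \<otimes> h) i = tile_action g (tile_action h i)"
  using assms image_mult[OF assms(1,2) tile_subset[OF assms(3)]]
  by (simp add: tile_action_eq_iff tile_action_closed tile_tile_action)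

lemma tile_action_inv:
  assumes "g \<in> carrier G" "i \<in> I"
  shows "tile_action (inv g) (tile_action g i) = i"
  using assms image_inv[OF assms(1) tile_subset[OF assms(2)]]
  by (simp add: tile_action_eq_iff tile_action_closed tile_tile_action)

text \<open>Stated for subgroups to serve both \<open>H\<close> and, through
  \<open>carrier G\<close>, the whole group.\<close>

lemma group_action_tile_action:
  assumes H: "subgroup H G"
  shows "group_action (G\<lparr>carrier := H\<rparr>) I tile_action"
proof -
  have HG: "g \<in> carrier G" if "g \<in> H" for g using subgroup.mem_carrier[OF H that] .
  have "tile_action g \<in> Bij I" if g: "g \<in> carrier G" for g
  proof -
    have "bij_betw (tile_action g) I I"
    proof (rule bij_betw_byWitness[where f' = "tile_action (inv g)"])
      show "\<forall>i\<in>I. tile_action (inv g) (tile_action g i) = i"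
        using tile_action_inv g by blast
      show "\<forall>i\<in>I. tile_action g (tile_action (inv g) i) = i"
        using tile_action_inv[of "inv g"] g by simp
    qed (use tile_action_closed g in auto)
    then show ?thesis by (simp add: Bij_def tile_action_def)
  qed
  moreover have "tile_action (g \<otimes> h) = compose I (tile_action g) (tile_action h)"
    if "g \<in> carrier G" "h \<in> carrier G" for g h
  proof (rule extensionalityI[of _ I])
    show "tile_action (g \<otimes> h) \<in> extensional I" by (simp add: tile_action_def)
    show "compose I (tile_action g) (tile_action h) \<in> extensional I" by (rule compose_extensional)
    show "tile_action (g \<otimes> h) i = compose I (tile_action g) (tile_action h) i" if "i \<in> I" for i
      using tile_action_mult \<open>g \<in> carrier G\<close> \<open>h \<in> carrier G\<close> that by (simp add: compose_eq)
  qed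
  ultimately have "tile_action \<in> hom (G\<lparr>carrier := H\<rparr>) (BijGroup I)"
    using HG by (auto simp: hom_def BijGroup_def)
  then show ?thesis
    unfolding group_action_def group_hom_def group_hom_axioms_def
    using group_BijGroup subgroup_imp_group[OF H] by blast
qed

text \<open>The action is merely by homeomorphisms, so this rests on invariance of dimension for
  injective continuous maps on convex sets, applied to \<open>g\<close> and to
  \<open>inv g\<close>.\<close>

lemma aff_dim_image:
  assumes g: "g \<in> carrier G" and S: "S \<subseteq> P" "convex S" "convex (\<phi> g ` S)"
  shows "aff_dim (\<phi> g ` S) = aff_dim S"
proof -
  have le: "aff_dim T \<le> aff_dim (\<phi> h ` T)" if h: "h \<in> carrier G" and T: "T \<subseteq> P" "convex T" for h T
  proof (rule invariance_of_dimension_convex_domain[OF T(2)])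
    show "continuous_on T (\<phi> h)" using continuous_action[OF h] T(1) continuous_on_subset by blast
    show "\<phi> h \<in> T \<rightarrow> affine hull \<phi> h ` T" by (auto intro: hull_inc)
    show "inj_on (\<phi> h) T" using inj_prop[OF h] T(1) inj_on_subset by blast
  qed
  have "\<phi> g ` S \<subseteq> P" using surj_prop[OF g] S(1) by blast
  then show ?thesis
    using le[OF g S(1,2)] le[OF inv_closed[OF g] _ S(3)] image_inv[OF g S(1)] by simp
qed

lemma adjacent_tile_action:
  assumes g: "g \<in> carrier G" and i: "i \<in> I" "i' \<in> I" and adj: "adjacent D i i'"
  shows "adjacent D (tile_action g i) (tile_action g i')"
proof -
  have "\<phi> g ` (D i \<inter> D i') = D (tile_action g i) \<inter> D (tile_action g i')"
    using inj_on_image_Int[OF inj_prop[OF g] tile_subset[OF i(1)] tile_subset[OF i(2)]]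
      tile_tile_action[OF g] i by simp
  moreover have "aff_dim (\<phi> g ` (D i \<inter> D i')) = aff_dim (D i \<inter> D i')"
    using calculation tile_subset[OF i(1)] convex_tile tile_action_closed[OF g] i
    by (intro aff_dim_image[OF g]) (auto intro: convex_Int)
  moreover have "tile_action g i \<noteq> tile_action g i'"
    using adj tile_action_inv[OF g] i by (metis adjacent_iff)
  ultimately show ?thesis
    using adj adjacent_iff i tile_action_closed[OF g] by simp
qed

lemma card_neighbours: "i \<in> I \<Longrightarrow> card {i' \<in> I. adjacent D i i'} = card {F. F facet_of D i}"
  using bij_betw_facets by (rule bij_betw_same_card)

lemma finite_neighbours: "i \<in> I \<Longrightarrow> finite {i' \<in> I. adjacent D i i'}"
  using bij_betw_finite[OF bij_betw_facets] finite_facets by blast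

text \<open>Facets are counted as neighbours, which a group element carrying \<open>i\<close> to
  \<open>i'\<close> maps injectively; the opposite inequality is symmetric.\<close>

lemma card_facets_eq:
  assumes "i \<in> I" "i' \<in> I"
  shows "card {F. F facet_of D i} = card {F. F facet_of D i'}"
proof -
  have "card {l \<in> I. adjacent D i l} \<le> card {l \<in> I. adjacent D i' l}"
    if i: "i \<in> I" "i' \<in> I" for i i'
  proof -
    obtain g where g: "g \<in> carrier G" "\<phi> g ` D i = D i'"
      using tiles_transitive[OF i] by blast
    then have "tile_action g i = i'" using tile_action_eq_iff i by blast
    then have "tile_action g ` {l \<in> I. adjacent D i l} \<subseteq> {l \<in> I. adjacent D i' l}"
      using adjacent_tile_action[OF g(1) i(1)] tile_action_closed[OF g(1)] by auto
    moreover have "inj_on (tile_action g) {l \<in> I. adjacent D i l}"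
      by (rule inj_on_inverseI[where g = "tile_action (inv g)"]) (use tile_action_inv g in auto)
    ultimately show ?thesis using card_inj_on_le finite_neighbours[OF i(2)] by blast
  qed
  then have "card {l \<in> I. adjacent D i l} = card {l \<in> I. adjacent D i' l}"
    using assms by (intro antisym)
  then show ?thesis using card_neighbours[OF assms(1)] card_neighbours[OF assms(2)] by simp
qed

text \<open>A proper face misses the interior of its tile.\<close>

lemma tile_of_interior_point:
  assumes i: "i \<in> I" "i' \<in> I" and x: "x \<in> interior (D i)" "x \<in> D i'"
  shows "i' = i"
proof (rule ccontr)
  assume "i' \<noteq> i"
  then have "D i \<inter> D i' face_of D i" "aff_dim (D i \<inter> D i') \<le> int CARD('n) - 1"
    using face_to_face[OF i] x interior_subset[of "D i"] by auto
  moreover from this have "D i \<inter> D i' \<noteq> D i" using aff_dim_tile[OF i(1)] by auto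
  ultimately have "(D i \<inter> D i') \<inter> interior (D i) = {}"
    by (intro face_of_disjoint_interior)
  then show False using x interior_subset[of "D i"] by blast
qed

lemma tile_stabilizer_eq:
  assumes "i \<in> I"
  shows "tile_stabilizer G \<phi> (D i) = stabilizer G tile_action i"
  using tile_action_eq_iff[OF _ assms assms] by (auto simp: tile_stabilizer_def stabilizer_def)

section \<open>Fundamental subsets: orbits, counting and generation\<close>

context
  fixes H J assumes H: "subgroup H G" and J: "fundamental_subset H P \<phi> I D J"
begin

lemma fundamental_subset_index: "J \<subseteq> I"
  using J by (simp add: fundamental_subset_def)

text \<open>The covering condition concerns points; an interior point of \<open>D i\<close> turns it
  into a statement on tiles.\<close>

lemma fundamental_subset_reach:
  assumes i: "i \<in> I"
  shows "\<exists>h\<in>H. \<exists>j\<in>J. tile_action h j = i"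
proof -
  obtain x where x: "x \<in> interior (D i)" using interior_tile[OF i] by blast
  then have "x \<in> P" using interior_subset[of "D i"] tile_subset[OF i] by blast
  then have "x \<in> (\<Union>g\<in>H. \<Union>j\<in>J. \<phi> g ` D j)"
    using J unfolding fundamental_subset_def by blast
  then obtain h j where h: "h \<in> H" "j \<in> J" "x \<in> \<phi> h ` D j" by blast
  have hG: "h \<in> carrier G" and jI: "j \<in> I"
    using subgroup.mem_carrier[OF H h(1)] fundamental_subset_index h(2) by auto
  have "x \<in> D (tile_action h j)" using tile_tile_action[OF hG jI] h(3) by simp
  then have "tile_action h j = i"
    using tile_of_interior_point[OF i tile_action_closed[OF hG jI] x] by simp
  then show ?thesis using h by blast
qed

lemma fundamental_subset_inequivalent:
  assumes "h \<in> H" "j \<in> J" "j' \<in> J" "tile_action h j = j'"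
  shows "j = j'"
proof -
  have "\<phi> h ` D j = D j'"
    using assms tile_action_eq_iff[of h j j'] subgroup.mem_carrier[OF H] fundamental_subset_index
    by blast
  then show ?thesis using J assms unfolding fundamental_subset_def by blast
qed

context
  fixes i\<^sub>0 assumes i0: "i\<^sub>0 \<in> I"
begin

lemma obtain_representatives:
  obtains r where "\<And>j. j \<in> J \<Longrightarrow> r j \<in> carrier G \<and> tile_action (r j) i\<^sub>0 = j"
proof -
  have "\<exists>g. g \<in> carrier G \<and> tile_action g i\<^sub>0 = j" if "j \<in> J" for j
    using tiles_transitive[OF i0, of j] tile_action_eq_iff[OF _ i0, of _ j]
      that fundamental_subset_index by blast
  then show thesis using that by metis
qed

text \<open>If the representatives of two members of \<open>J\<close> shared a coset of
  \<open>H\<close>, the two would be \<open>H\<close>-equivalent; so \<open>J\<close> injects into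
  the cosets.\<close>

lemma finite_fundamental_subset:
  assumes fin: "finite (rcosets H)"
  shows "finite J"
proof -
  obtain r where r: "\<And>j. j \<in> J \<Longrightarrow> r j \<in> carrier G \<and> tile_action (r j) i\<^sub>0 = j"
    by (rule obtain_representatives) blast
  have "inj_on (\<lambda>j. H #> r j) J"
  proof (rule inj_onI)
    fix j j' assume j: "j \<in> J" "j' \<in> J" and eq: "H #> r j = H #> r j'"
    have "r j' \<in> H #> r j" using rcos_self[OF _ H, of "r j'"] r j eq by simp
    then obtain h where h: "h \<in> H" "r j' = h \<otimes> r j" by (auto simp: r_coset_def)
    have "tile_action (r j') i\<^sub>0 = tile_action h j"
      unfolding h(2)
      using tile_action_mult[of h "r j" i\<^sub>0] r[OF j(1)] subgroup.mem_carrier[OF H h(1)] i0 by simp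
    then have "tile_action h j = j'" using r[OF j(2)] by simp
    then show "j = j'" using fundamental_subset_inequivalent h(1) j by blast
  qed
  moreover have "(\<lambda>j. H #> r j) ` J \<subseteq> rcosets H"
    using r by (auto simp: RCOSETS_def)
  ultimately show ?thesis using fin inj_on_finite by blast
qed

text \<open>By transitivity the tiles are the cosets of the stabilizer of \<open>i\<^sub>0\<close>,
  and \<open>J\<close> picks one from each \<open>H\<close>-orbit.\<close>

lemma card_fundamental_subset:
  "card J = card (double_cosets G H (tile_stabilizer G \<phi> (D i\<^sub>0)))"
proof -
  let ?K = "stabilizer G tile_action i\<^sub>0"
  let ?dc = "\<lambda>g. {h \<otimes> g \<otimes> k | h k. h \<in> H \<and> k \<in> ?K}"
  have HG: "h \<in> carrier G" if "h \<in> H" for h using subgroup.mem_carrier[OF H that] .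
  interpret T: group_action G I tile_action
    using group_action_tile_action[OF subgroup_self] by simp
  have K: "subgroup ?K G" by (rule T.stabilizer_subgroup[OF i0])
  obtain r where r: "\<And>j. j \<in> J \<Longrightarrow> r j \<in> carrier G \<and> tile_action (r j) i\<^sub>0 = j"
    by (rule obtain_representatives) blast
  have "inj_on (\<lambda>j. ?dc (r j)) J"
  proof (rule inj_onI)
    fix j j' assume j: "j \<in> J" "j' \<in> J" and eq: "?dc (r j) = ?dc (r j')"
    have "r j = \<one> \<otimes> r j \<otimes> \<one>" using r j by simp
    then have "r j \<in> ?dc (r j)" using subgroup.one_closed[OF H] subgroup.one_closed[OF K] by blast
    then obtain h k where h: "h \<in> H" "k \<in> ?K" "r j = h \<otimes> r j' \<otimes> k" using eq by blast
    have k: "k \<in> carrier G" "tile_action k i\<^sub>0 = i\<^sub>0" using h(2) by (auto simp: stabilizer_def)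
    have "j = tile_action (h \<otimes> r j' \<otimes> k) i\<^sub>0" using r j h(3) by metis
    also have "\<dots> = tile_action h j'"
      using HG[OF h(1)] r[OF j(2)] k i0 by (simp add: tile_action_mult)
    finally show "j = j'" using fundamental_subset_inequivalent[OF h(1) j(2,1)] by simp
  qed
  moreover have "(\<lambda>j. ?dc (r j)) ` J = double_cosets G H ?K"
  proof
    show "(\<lambda>j. ?dc (r j)) ` J \<subseteq> double_cosets G H ?K"
      using r unfolding double_cosets_def by blast
    show "double_cosets G H ?K \<subseteq> (\<lambda>j. ?dc (r j)) ` J"
    proof
      fix X assume "X \<in> double_cosets G H ?K"
      then obtain g where g: "g \<in> carrier G" "X = ?dc g" unfolding double_cosets_def by blast
      obtain h j where h: "h \<in> H" "j \<in> J" "tile_action h j = tile_action g i\<^sub>0"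
        using fundamental_subset_reach[OF tile_action_closed[OF g(1) i0]] by blast
      have a: "h \<otimes> r j \<in> carrier G" using HG h r by simp
      have act: "tile_action (h \<otimes> r j) i\<^sub>0 = tile_action g i\<^sub>0"
        using tile_action_mult[of h "r j" i\<^sub>0] HG h r i0 by simp
      \<comment> \<open>\<open>g\<close> and \<open>h \<otimes> r j\<close> send
        \<open>i\<^sub>0\<close> to the same tile, so they differ by an element of its
        stabilizer.\<close>
      let ?k = "inv (h \<otimes> r j) \<otimes> g"
      have "tile_action ?k i\<^sub>0 = i\<^sub>0"
        using tile_action_inv[OF a i0] act tile_action_mult[OF inv_closed[OF a] g(1) i0] by simp
      then have "?k \<in> ?K" using a g by (simp add: stabilizer_def del: inv_mult_group)
      moreover have "g = h \<otimes> r j \<otimes> ?k"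
        using a g by (simp flip: m_assoc del: inv_mult_group)
      ultimately have "X = ?dc (r j)"
        using double_coset_eq[OF H K _ h(1)] r h(2) g(2) by blast
      then show "X \<in> (\<lambda>j. ?dc (r j)) ` J" using h(2) by blast
    qed
  qed
  ultimately have "bij_betw (\<lambda>j. ?dc (r j)) J (double_cosets G H ?K)"
    by (rule bij_betw_imageI)
  then have "card J = card (double_cosets G H ?K)"
    by (rule bij_betw_same_card)
  then show ?thesis using tile_stabilizer_eq[OF i0] by simp
qed

lemma card_adjacent_pairs:
  assumes "finite J" and i: "i \<in> I"
  shows "finite (adjacent_pairs D J I)"
    and "card (adjacent_pairs D J I) = card J * card {F. F facet_of D i}"
proof -
  have eq: "adjacent_pairs D J I = Sigma J (\<lambda>j. {i' \<in> I. adjacent D j i'})"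
    by (auto simp: adjacent_pairs_def)
  have JI: "j \<in> I" if "j \<in> J" for j using that fundamental_subset_index by blast
  show "finite (adjacent_pairs D J I)"
    unfolding eq using assms(1) finite_neighbours JI by blast
  have "card (adjacent_pairs D J I) = (\<Sum>j\<in>J. card {i' \<in> I. adjacent D j i'})"
    unfolding eq using assms(1) finite_neighbours JI by simp
  also have "\<dots> = (\<Sum>j\<in>J. card {F. F facet_of D i})"
    using card_neighbours card_facets_eq[OF _ i] JI by (intro sum.cong) auto
  finally show "card (adjacent_pairs D J I) = card J * card {F. F facet_of D i}" by simp
qed

text \<open>\<open>i\<^sub>0\<close> need not belong to \<open>J\<close>. Some
  \<open>h\<^sub>0\<close> in \<open>H\<close> carries a member \<open>j\<^sub>0\<close> of
  \<open>J\<close> to it, and conjugation by \<open>h\<^sub>0\<close> turns generators at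
  \<open>i\<^sub>0\<close> into equally few at \<open>j\<^sub>0\<close>.\<close>

lemma generators_of_subgroup:
  assumes fg: "finitely_generated G" and finJ: "finite J"
  shows "\<exists>S. finite S \<and> S \<subseteq> H \<and> generate G S = H \<and>
    card S + card (adjacent_pairs D J J) \<le> card (adjacent_pairs D J I) +
      min_generators (G\<lparr>carrier := tile_stabilizer G \<phi> (D i\<^sub>0) \<inter> H\<rparr>)"
proof -
  let ?GH = "G\<lparr>carrier := H\<rparr>" and ?M = "tile_stabilizer G \<phi> (D i\<^sub>0) \<inter> H"
  have HG: "h \<in> carrier G" if "h \<in> H" for h using subgroup.mem_carrier[OF H that] .
  interpret T: group_action ?GH I tile_action by (rule group_action_tile_action[OF H])
  have M: "?M = stabilizer ?GH tile_action i\<^sub>0"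
    using tile_stabilizer_eq[OF i0] HG by (auto simp: stabilizer_def)
  have "subgroup ?M ?GH"
    unfolding M by (rule T.stabilizer_subgroup[OF i0])
  then have MG: "subgroup ?M G" using incl_subgroup[OF H] by blast
  \<comment> \<open>Finiteness of the stabilizer ensures that its minimal number of generators is
    attained.\<close>
  have "finite ?M" using finite_stabilizer[OF i0] by blast
  then have "finitely_generated (G\<lparr>carrier := ?M\<rparr>)"
    using group.finitely_generated_of_finite[OF subgroup_imp_group[OF MG]] by simp
  then obtain T\<^sub>0 where T0: "finite T\<^sub>0" "T\<^sub>0 \<subseteq> ?M" "generate G T\<^sub>0 = ?M"
      "card T\<^sub>0 = min_generators (G\<lparr>carrier := ?M\<rparr>)"
    using min_generators_attained[of "G\<lparr>carrier := ?M\<rparr>"] generate_consistent[OF _ MG] by auto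
  obtain h\<^sub>0 j\<^sub>0 where h0: "h\<^sub>0 \<in> H" "j\<^sub>0 \<in> J" "tile_action h\<^sub>0 j\<^sub>0 = i\<^sub>0"
    using fundamental_subset_reach[OF i0] by blast
  have h0G: "h\<^sub>0 \<in> carrier G" and j0I: "j\<^sub>0 \<in> I"
    using HG h0 fundamental_subset_index by auto
  have fin: "finite {i \<in> I. adjacent D j i}" if "j \<in> J" for j
    using finite_neighbours that fundamental_subset_index by blast
  have "\<exists>T. T \<subseteq> carrier ?GH \<and> finite T \<and>
    card T + card {(j, i). j \<in> J \<and> i \<in> J \<and> adjacent D j i}
      \<le> card {(j, i). j \<in> J \<and> i \<in> I \<and> adjacent D j i} \<and>
    (\<forall>L. subgroup L ?GH \<longrightarrow> T \<subseteq> L \<longrightarrow> stabilizer ?GH tile_action j\<^sub>0 \<subseteq> L \<longrightarrow> L = carrier ?GH)"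
  proof (rule T.generators_from_adjacency[OF fundamental_subset_index finJ fin adjacent_sym _ _ _ _ h0(2)])
    show "adjacent D (tile_action g i) (tile_action g i')"
      if "g \<in> carrier ?GH" "i \<in> I" "i' \<in> I" "adjacent D i i'" for g i i'
      using adjacent_tile_action HG that by simp
    show "C = I"
      if "C \<subseteq> I" "C \<noteq> {}" "\<And>i i'. i \<in> C \<Longrightarrow> i' \<in> I \<Longrightarrow> adjacent D i i' \<Longrightarrow> i' \<in> C" for C
      using adjacency_connected[OF fg that] .
    show "\<exists>g\<in>carrier ?GH. \<exists>j\<in>J. tile_action g j = i" if "i \<in> I" for i
      using fundamental_subset_reach[OF that] by simp
    show "j = j'" if "g \<in> carrier ?GH" "j \<in> J" "j' \<in> J" "tile_action g j = j'" for g j j'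
      using fundamental_subset_inequivalent that by simp
  qed
  then obtain T where T: "T \<subseteq> H" "finite T"
    and cardT: "card T + card (adjacent_pairs D J J) \<le> card (adjacent_pairs D J I)"
    and gen: "\<And>L. subgroup L ?GH \<Longrightarrow> T \<subseteq> L \<Longrightarrow> stabilizer ?GH tile_action j\<^sub>0 \<subseteq> L \<Longrightarrow> L = H"
    by (auto simp: adjacent_pairs_def)
  define T\<^sub>1 where "T\<^sub>1 = (\<lambda>t. inv h\<^sub>0 \<otimes> t \<otimes> h\<^sub>0) ` T\<^sub>0"
  define L where "L = generate G (T \<union> T\<^sub>1)"
  have T1H: "T\<^sub>1 \<subseteq> H"
    using T0(2) h0(1) subgroup.m_closed[OF H] subgroup.m_inv_closed[OF H] by (auto simp: T\<^sub>1_def)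
  then have TH: "T \<union> T\<^sub>1 \<subseteq> H" using T by blast
  then have LG: "subgroup L G"
    unfolding L_def using HG by (intro generate_is_subgroup) blast
  have LH: "L \<subseteq> H" unfolding L_def by (rule generate_subgroup_incl[OF TH H])
  have incl: "T \<union> T\<^sub>1 \<subseteq> L" unfolding L_def by (intro subsetI generate.incl)
  \<comment> \<open>Checked on the generators \<open>T\<^sub>0\<close>, whose conjugates form
    \<open>T\<^sub>1\<close>.\<close>
  have sub: "?M \<subseteq> {x \<in> carrier G. inv h\<^sub>0 \<otimes> x \<otimes> h\<^sub>0 \<in> L}"
    unfolding T0(3)[symmetric]
  proof (rule generate_subgroup_incl[OF _ subgroup_conjugate_vimage[OF LG h0G]])
    show "T\<^sub>0 \<subseteq> {x \<in> carrier G. inv h\<^sub>0 \<otimes> x \<otimes> h\<^sub>0 \<in> L}"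
      using T0(2) HG incl by (auto simp: T\<^sub>1_def)
  qed
  have "stabilizer ?GH tile_action j\<^sub>0 \<subseteq> L"
  proof
    fix s assume "s \<in> stabilizer ?GH tile_action j\<^sub>0"
    then have s: "s \<in> H" "s \<in> carrier G" "tile_action s j\<^sub>0 = j\<^sub>0" using HG by (auto simp: stabilizer_def)
    let ?s = "h\<^sub>0 \<otimes> s \<otimes> inv h\<^sub>0"
    have "tile_action (inv h\<^sub>0) i\<^sub>0 = j\<^sub>0" using tile_action_inv[OF h0G j0I] h0(3) by simp
    then have "tile_action ?s i\<^sub>0 = i\<^sub>0"
      using s h0(3) h0G i0 j0I by (simp add: tile_action_mult)
    moreover have "?s \<in> H"
      using s(1) h0(1) subgroup.m_closed[OF H] subgroup.m_inv_closed[OF H] by blast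
    ultimately have "?s \<in> ?M" unfolding M by (simp add: stabilizer_def)
    then have "inv h\<^sub>0 \<otimes> ?s \<otimes> h\<^sub>0 \<in> L" using sub by blast
    moreover have "inv h\<^sub>0 \<otimes> ?s \<otimes> h\<^sub>0 = s"
      using h0G s(2) by (metis inv_closed inv_solve_left inv_solve_right m_closed m_assoc)
    ultimately show "s \<in> L" by simp
  qed
  moreover have "subgroup L ?GH" using subgroup_incl[OF LG H LH] .
  ultimately have "L = H" using gen incl by blast
  moreover have "card (T \<union> T\<^sub>1) \<le> card T + card T\<^sub>0"
    using card_Un_le[of T T\<^sub>1] card_image_le[OF T0(1), of "\<lambda>t. inv h\<^sub>0 \<otimes> t \<otimes> h\<^sub>0"]
    by (simp add: T\<^sub>1_def)
  ultimately show ?thesis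
    using cardT T0(1,4) T(2) TH unfolding L_def
    by (intro exI[of _ "T \<union> T\<^sub>1"]) (simp add: T\<^sub>1_def)
qed

end
end
end

section \<open>The generator bound for a subgroup of finite index\<close>

theorem theorem3p3:
  fixes G :: "('g, 'm) monoid_scheme" (structure)
    and P :: "(real ^ 'n) set"
    and \<phi> :: "'g \<Rightarrow> real ^ 'n \<Rightarrow> real ^ 'n"
    and I J :: "'i set"
    and D :: "'i \<Rightarrow> (real ^ 'n) set"
    and H K :: "'g set"
    and i\<^sub>0 :: 'i
  assumes "finitely_generated G"
    and "exact_tessellation G P \<phi> I D"
    and "subgroup H G"
    and "finite (rcosets H)"
    and "i\<^sub>0 \<in> I"
    and "K = tile_stabilizer G \<phi> (D i\<^sub>0)"
    and "fundamental_subset H P \<phi> I D J"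
  shows "finitely_generated (G\<lparr>carrier := H\<rparr>) \<and>
         finite (adjacent_pairs D J I) \<and>
         int (min_generators (G\<lparr>carrier := H\<rparr>)) \<le>
           int (card (adjacent_pairs D J I)) - int (card (adjacent_pairs D J J))
             + int (min_generators (G\<lparr>carrier := K \<inter> H\<rparr>)) \<and>
         finite J \<and>
         card J = card (double_cosets G H K) \<and>
         (\<forall>i\<in>I. finite {F. F facet_of D i} \<and>
           min_generators (G\<lparr>carrier := H\<rparr>) \<le>
             card J * card {F. F facet_of D i} + min_generators (G\<lparr>carrier := K \<inter> H\<rparr>))"
proof -
  interpret exact_tessellation G P \<phi> I D by fact
  interpret group G using group_hom group_hom.axioms(1) by auto
  note H = assms(3) and i0 = assms(5) and K = assms(6) and J = assms(7)
  have finJ: "finite J"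
    by (rule finite_fundamental_subset[OF H J i0 assms(4)])
  obtain S where S: "finite S" "S \<subseteq> H" "generate G S = H"
    and card: "card S + card (adjacent_pairs D J J)
      \<le> card (adjacent_pairs D J I) + min_generators (G\<lparr>carrier := K \<inter> H\<rparr>)"
    using generators_of_subgroup[OF H J i0 assms(1) finJ] K by blast
  have gen: "generate (G\<lparr>carrier := H\<rparr>) S = H"
    using generate_consistent[OF S(2) H] S(3) by simp
  have "min_generators (G\<lparr>carrier := H\<rparr>) \<le> card S"
    using min_generators_le[of S "G\<lparr>carrier := H\<rparr>"] S gen by simp
  \<comment> \<open>Kept as a comparison of sums, since subtraction on \<open>nat\<close> truncates;
    the integer form follows.\<close>
  then have bound: "min_generators (G\<lparr>carrier := H\<rparr>) + card (adjacent_pairs D J J)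
      \<le> card (adjacent_pairs D J I) + min_generators (G\<lparr>carrier := K \<inter> H\<rparr>)"
    using card by linarith
  have "finitely_generated (G\<lparr>carrier := H\<rparr>)"
    unfolding finitely_generated_def using S gen by auto
  moreover have "card J = card (double_cosets G H K)"
    unfolding K by (rule card_fundamental_subset[OF H J i0])
  \<comment> \<open>The pairs inside \<open>J\<close> are discarded, and each member of
    \<open>J\<close> has as many neighbours as \<open>D i\<close> has facets.\<close>
  moreover have "finite {F. F facet_of D i} \<and> min_generators (G\<lparr>carrier := H\<rparr>) \<le>
      card J * card {F. F facet_of D i} + min_generators (G\<lparr>carrier := K \<inter> H\<rparr>)" if "i \<in> I" for i
    using bound card_adjacent_pairs(2)[OF H J i0 finJ that] finite_facets[OF that] by linarith
  ultimately show ?thesis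
    using bound finJ card_adjacent_pairs(1)[OF H J i0 finJ i0] by auto
qed

end
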